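(* Let $\Bbbk$ be a field, $\mathbf{P}$ a finite poset, $\xi=(\xi_I\colon I^\xi\to\mathbf{P})_{I\in\mathbb{I}}$ a compression system for $\Bbbk[\mathbf{P}]$, $M\in\operatorname{mod}\Bbbk[\mathbf{P}]$, and $I$ an interval of $\mathbf{P}$. Write $\operatorname{sc}(I^\xi)=\{a_1,\dots,a_n\}$ and $\operatorname{sk}(I^\xi)=\{b_1,\dots,b_m\}$ (elements pairwise distinct, $m,n\ge1$), numbered so that $a_1\le b_1$. Then $$\operatorname{mult}^\xi_I M=\operatorname{rank}\begin{bmatrix}\tilde{\mathbf{M}}&\mathbf{0}\\ \begin{bmatrix}M_{\xi_I(b_1),\xi_I(a_1)}&\mathbf{0}\\ \mathbf{0}&\mathbf{0}\end{bmatrix}&\hat{\mathbf{M}}\end{bmatrix}-\operatorname{rank}\tilde{\mathbf{M}}-\operatorname{rank}\hat{\mathbf{M}},$$ where $\tilde{\mathbf{M}}$ and $\hat{\mathbf{M}}$ are the block matrices defined in the context. If $m=1$ (resp. $n=1$) then $\hat{\mathbf{M}}$ (resp. $\tilde{\mathbf{M}}$) is an empty matrix, and the formula has one of the following special forms: for $n=m=1$, $\operatorname{mult}^\xi_IM=\operatorname{rank}M_{\xi_I(b_1),\xi_I(a_1)}$; for $n\ge2$, $m=1$, $$\operatorname{mult}^\xi_IM=\operatorname{rank}\begin{bmatrix}\tilde{\mathbf{M}}\\ M_{\xi_I(b_1),\xi_I(a_1)}\ \ \mathbf{0}\ \cdots\ \mathbf{0}\end{bmatrix}-\operatorname{rank}\tilde{\mathbf{M}};$$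 for $n=1$, $m\ge2$, $$\operatorname{mult}^\xi_IM=\operatorname{rank}\big[\hat{\mathbf{M}}\ \ \hat\beta\big]-\operatorname{rank}\hat{\mathbf{M}},$$ where $\hat\beta$ is the block column with first entry $M_{\xi_I(b_1),\xi_I(a_1)}$ and the other $m-1$ entries zero.
   Context: Incidence category and modules: $\Bbbk[\mathbf{P}]$ is the $\Bbbk$-linear category with object set $\mathbf{P}$, $\Bbbk[\mathbf{P}](x,y)=\Bbbk p_{y,x}$ (one-dimensional) if $x\le y$ and $0$ otherwise, $p_{z,y}p_{y,x}=p_{z,x}$, identities $p_{x,x}$. An order-preserving map $f$ induces a linear functor $\Bbbk[f]$ by $x\mapsto f(x)$, $p_{y,x}\mapsto p_{f(y),f(x)}$. $\operatorname{mod}\Bbbk[\mathbf{P}]$ is the category of $\Bbbk$-linear functors $\Bbbk[\mathbf{P}]\to\operatorname{mod}\Bbbk$ (finite-dimensional vector spaces). For $M$ in it and $x\le y$, $M_{y,x}:=M(p_{y,x})\colon M(x)\to M(y)$. Intervals: a nonempty full subposet $I\subseteq\mathbf{P}$ is an interval if it is connected (any two elements are joined by a finite sequence in $I$ whose consecutive elements are comparable) and convex. $\mathbb{I}$ is the set of all intervals. For a finite poset $S$, $\operatorname{sc}(S)$ and $\operatorname{sk}(S)$ are its sets of minimal and maximal elements. The interval module $V_I$ has $V_I(x)=\Bbbk$ for $x\in I$, $0$ otherwise, and $V_I(p_{y,x})=\mathrm{id}_\Bbbk$ if $x\le y$ are both in $I$, $0$ otherwise. A compression system $\xi=(\xi_I)_{I\in\mathbb{I}}$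 is a family of order-preserving maps $\xi_I\colon I^\xi\to\mathbf{P}$ from connected (nonempty) finite posets $I^\xi$ such that for all $I$: (1) the image of $\xi_I$ is contained in $I$; (2) it contains $\operatorname{sc}(I)\cup\operatorname{sk}(I)$. $R_I\colon\operatorname{mod}\Bbbk[\mathbf{P}]\to\operatorname{mod}\Bbbk[I^\xi]$ is $M\mapsto M\circ\Bbbk[\xi_I]$. The module $R_I(V_I)$ is indecomposable, and $\operatorname{mult}^\xi_IM$ is its multiplicity as a direct summand in the indecomposable decomposition of $R_I(M)$. Matrices: give $\operatorname{sc}(I^\xi)$ and $\operatorname{sk}(I^\xi)$ the total orders $a_1<\dots<a_n$ and $b_1<\dots<b_m$ of the numbering. For a two-element subset $\mathbf{a}$ (resp. $\mathbf{b}$) of one of these sets, $\underline{\mathbf{a}},\overline{\mathbf{a}}$ (resp. $\underline{\mathbf{b}},\overline{\mathbf{b}}$) denote its smaller and larger element in this total order. Let $\uparrow x=\{y\in I^\xi\mid x\le y\}$, $\downarrow x=\{y\in I^\xi\mid y\le x\}$, and $\operatorname{sc}_1(I^\xi)=\{\mathbf{a}_c=(\mathbf{a},c)\mid\mathbf{a}\subseteq\operatorname{sc}(I^\xi),|\mathbf{a}|=2,\ c\text{ a minimal element of }\uparrow\underline{\mathbf{a}}\cap\uparrow\overline{\mathbf{a}}\}$, $\operatorname{sk}_1(I^\xi)=\{\mathbf{b}_d=(\mathbf{b},d)\mid\mathbf{b}\subseteq\operatorname{sk}(I^\xi),|\mathbf{b}|=2,\ d\text{ a maximal element of }\downarrow\underline{\mathbf{b}}\cap\downarrow\overline{\mathbf{b}}\}$.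 Then $\tilde{\mathbf{M}}=[\tilde M_{\mathbf{a}_c,a}]$, with rows indexed by $\operatorname{sc}_1(I^\xi)$ and columns by $\operatorname{sc}(I^\xi)$, is the linear map $\bigoplus_{a}M(\xi_I(a))\to\bigoplus_{\mathbf{a}_c}M(\xi_I(c))$ with $\tilde M_{\mathbf{a}_c,a}=M_{\xi_I(c),\xi_I(a)}$ if $a=\underline{\mathbf{a}}$, $-M_{\xi_I(c),\xi_I(a)}$ if $a=\overline{\mathbf{a}}$, and $0$ if $a\notin\mathbf{a}$. Likewise $\hat{\mathbf{M}}=[\hat M_{b,\mathbf{b}_d}]$, with rows indexed by $\operatorname{sk}(I^\xi)$ and columns by $\operatorname{sk}_1(I^\xi)$, is the linear map $\bigoplus_{\mathbf{b}_d}M(\xi_I(d))\to\bigoplus_bM(\xi_I(b))$ with $\hat M_{b,\mathbf{b}_d}=M_{\xi_I(b),\xi_I(d)}$ if $b=\underline{\mathbf{b}}$, $-M_{\xi_I(b),\xi_I(d)}$ if $b=\overline{\mathbf{b}}$, and $0$ if $b\notin\mathbf{b}$. The lower-left block is the linear map $\bigoplus_aM(\xi_I(a))\to\bigoplus_bM(\xi_I(b))$ whose only possibly nonzero entry is $M_{\xi_I(b_1),\xi_I(a_1)}$ in position $(b_1,a_1)$. Empty matrices (no rows or no columns) represent maps from or to the zero space and have rank $0$. *)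

theory Defs
  imports Complex_Main "HOL-Library.FuncSet" "HOL-Library.Function_Algebras"
begin

section \<open>Posets\<close>

text \<open>
  A poset is given by its order relation \<open>r\<close> with \<^term>\<open>Partial_order r\<close>; its set of elements is
  \<^term>\<open>Field r\<close>, and \<open>x \<le> y\<close> is \<^term>\<open>(x, y) \<in> r\<close>.
  The up-set and the down-set of \<open>x\<close> are the library's \<^term>\<open>above r x\<close> and \<^term>\<open>under r x\<close>.
\<close>

definition minimals :: "'a rel \<Rightarrow> 'a set \<Rightarrow> 'a set" where
  "minimals r S = {x \<in> S. \<forall>y\<in>S. (y, x) \<in> r \<longrightarrow> y = x}"

definition maximals :: "'a rel \<Rightarrow> 'a set \<Rightarrow> 'a set" where
  "maximals r S = {x \<in> S. \<forall>y\<in>S. (x, y) \<in> r \<longrightarrow> y = x}"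

definition poset_connected :: "'a rel \<Rightarrow> 'a set \<Rightarrow> bool" where
  "poset_connected r S \<longleftrightarrow>
     (\<forall>x\<in>S. \<forall>y\<in>S. (x, y) \<in> ((r \<union> r\<inverse>) \<inter> S \<times> S)\<^sup>*)"

definition poset_convex :: "'a rel \<Rightarrow> 'a set \<Rightarrow> bool" where
  "poset_convex r S \<longleftrightarrow>
     (\<forall>x\<in>S. \<forall>z\<in>S. \<forall>y. (x, y) \<in> r \<and> (y, z) \<in> r \<longrightarrow> y \<in> S)"

definition poset_interval :: "'a rel \<Rightarrow> 'a set \<Rightarrow> bool" where
  "poset_interval r I \<longleftrightarrow>
     I \<noteq> {} \<and> I \<subseteq> Field r \<and> poset_connected r I \<and> poset_convex r I"

definition order_preserving :: "'a rel \<Rightarrow> 'b rel \<Rightarrow> ('a \<Rightarrow> 'b) \<Rightarrow> bool" where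
  "order_preserving q r f \<longleftrightarrow> (\<forall>x y. (x, y) \<in> q \<longrightarrow> (f x, f y) \<in> r)"

text \<open>
  \<open>Q I\<close> is (the order relation of) the poset \<open>I\<^sup>\<xi>\<close>.
\<close>

definition compression_system ::
    "'p rel \<Rightarrow> ('p set \<Rightarrow> 'i rel) \<Rightarrow> ('p set \<Rightarrow> 'i \<Rightarrow> 'p) \<Rightarrow> bool" where
  "compression_system P Q \<xi> \<longleftrightarrow>
     (\<forall>I. poset_interval P I \<longrightarrow>
        Partial_order (Q I) \<and> finite (Field (Q I)) \<and> Field (Q I) \<noteq> {} \<and>
        poset_connected (Q I) (Field (Q I)) \<and>
        order_preserving (Q I) P (\<xi> I) \<and>
        \<xi> I ` Field (Q I) \<subseteq> I \<and>
        minimals P I \<union> maximals P I \<subseteq> \<xi> I ` Field (Q I))"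


section \<open>Finite-dimensional vector spaces and linear maps\<close>

text \<open>
  Vector spaces are subspaces of an ambient vector space with scalar multiplication \<open>s\<close>
  (\<^term>\<open>vector_space s\<close>).  This loses no generality: any family of vector spaces
  embeds into its direct sum.  A linear map between subspaces is a function on the ambient
  types of which only the values on the source subspace are relevant.
\<close>

definition fin_dim :: "('k::field \<Rightarrow> 'v::ab_group_add \<Rightarrow> 'v) \<Rightarrow> 'v set \<Rightarrow> bool" where
  "fin_dim s V \<longleftrightarrow> (\<exists>B. finite B \<and> V = module.span s B)"

definition linear_between ::
    "('k::field \<Rightarrow> 'v::ab_group_add \<Rightarrow> 'v) \<Rightarrow> 'v set \<Rightarrow>
     ('k \<Rightarrow> 'w::ab_group_add \<Rightarrow> 'w) \<Rightarrow> 'w set \<Rightarrow> ('v \<Rightarrow> 'w) \<Rightarrow> bool" where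
  "linear_between s V t W f \<longleftrightarrow>
     (\<forall>v\<in>V. f v \<in> W) \<and>
     (\<forall>u\<in>V. \<forall>v\<in>V. f (u + v) = f u + f v) \<and>
     (\<forall>c. \<forall>v\<in>V. f (s c v) = t c (f v))"

definition lin_rank ::
    "('k::field \<Rightarrow> 'w::ab_group_add \<Rightarrow> 'w) \<Rightarrow> 'v set \<Rightarrow> ('v \<Rightarrow> 'w) \<Rightarrow> nat" where
  "lin_rank t V f = vector_space.dim t (f ` V)"


section \<open>Modules over the incidence category\<close>

text \<open>
  Morphisms \<open>x \<rightarrow> y\<close> of the incidence category \<open>k[q]\<close> are represented by the scalar
  \<open>c\<close> in \<open>c p\<^sub>y\<^sub>,\<^sub>x\<close>; composition is then multiplication of scalars and the identities are \<open>1\<close>.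
\<close>

definition inc_hom :: "'x rel \<Rightarrow> 'x \<Rightarrow> 'x \<Rightarrow> 'k::field set" where
  "inc_hom q x y = (if (x, y) \<in> q then UNIV else {0})"

text \<open>\<open>mor M x y c\<close> is \<open>M(c p\<^sub>y\<^sub>,\<^sub>x) : M(x) \<rightarrow> M(y)\<close>.\<close>

record ('x, 'k, 'v) inc_functor =
  obj :: "'x \<Rightarrow> 'v set"
  mor :: "'x \<Rightarrow> 'x \<Rightarrow> 'k \<Rightarrow> 'v \<Rightarrow> 'v"

definition inc_module ::
    "'x rel \<Rightarrow> ('k::field \<Rightarrow> 'v::ab_group_add \<Rightarrow> 'v) \<Rightarrow> ('x, 'k, 'v) inc_functor \<Rightarrow> bool" where
  "inc_module q s M \<longleftrightarrow>
     vector_space s \<and>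
     (\<forall>x\<in>Field q. fin_dim s (obj M x)) \<and>
     (\<forall>x\<in>Field q. \<forall>y\<in>Field q. \<forall>c\<in>inc_hom q x y.
        linear_between s (obj M x) s (obj M y) (mor M x y c)) \<and>
     (\<forall>x\<in>Field q. \<forall>y\<in>Field q. \<forall>c\<in>inc_hom q x y. \<forall>d\<in>inc_hom q x y. \<forall>v\<in>obj M x.
        mor M x y (c + d) v = mor M x y c v + mor M x y d v) \<and>
     (\<forall>x\<in>Field q. \<forall>y\<in>Field q. \<forall>e. \<forall>c\<in>inc_hom q x y. \<forall>v\<in>obj M x.
        mor M x y (e * c) v = s e (mor M x y c v)) \<and>
     (\<forall>x\<in>Field q. \<forall>v\<in>obj M x. mor M x x 1 v = v) \<and>
     (\<forall>x\<in>Field q. \<forall>y\<in>Field q. \<forall>z\<in>Field q.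
        \<forall>c\<in>inc_hom q x y. \<forall>d\<in>inc_hom q y z. \<forall>v\<in>obj M x.
        mor M x z (d * c) v = mor M y z d (mor M x y c v))"

text \<open>\<open>smap M y x\<close> is the structure map \<open>M\<^sub>y\<^sub>,\<^sub>x = M(p\<^sub>y\<^sub>,\<^sub>x)\<close>.\<close>

definition smap :: "('x, 'k::field, 'v) inc_functor \<Rightarrow> 'x \<Rightarrow> 'x \<Rightarrow> 'v \<Rightarrow> 'v" where
  "smap M y x = mor M x y 1"

text \<open>
  Composition with \<open>k[f]\<close>, which sends \<open>x\<close> to \<open>f x\<close> and \<open>c p\<^sub>y\<^sub>,\<^sub>x\<close> to \<open>c p\<^sub>f\<^sub>y\<^sub>,\<^sub>f\<^sub>x\<close>.
\<close>

definition pullback :: "('i \<Rightarrow> 'p) \<Rightarrow> ('p, 'k, 'v) inc_functor \<Rightarrow> ('i, 'k, 'v) inc_functor" where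
  "pullback f M = \<lparr>obj = (\<lambda>x. obj M (f x)), mor = (\<lambda>x y. mor M (f x) (f y))\<rparr>"

text \<open>The field \<open>k\<close> is a vector space over itself with scalar multiplication \<^term>\<open>(*)\<close>.\<close>

definition interval_module :: "'p rel \<Rightarrow> 'p set \<Rightarrow> ('p, 'k::field, 'k) inc_functor" where
  "interval_module r I =
     \<lparr>obj = (\<lambda>x. if x \<in> I then UNIV else {0}),
      mor = (\<lambda>x y c v. if x \<in> I \<and> y \<in> I \<and> (x, y) \<in> r then c * v else 0)\<rparr>"

definition inc_iso ::
    "'x rel \<Rightarrow> ('k::field \<Rightarrow> 'v::ab_group_add \<Rightarrow> 'v) \<Rightarrow> ('x, 'k, 'v) inc_functor \<Rightarrow>
     ('k \<Rightarrow> 'w::ab_group_add \<Rightarrow> 'w) \<Rightarrow> ('x, 'k, 'w) inc_functor \<Rightarrow> bool" where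
  "inc_iso q s M t N \<longleftrightarrow>
     (\<exists>\<phi>. (\<forall>x\<in>Field q. linear_between s (obj M x) t (obj N x) (\<phi> x) \<and>
                        bij_betw (\<phi> x) (obj M x) (obj N x)) \<and>
          (\<forall>x\<in>Field q. \<forall>y\<in>Field q. \<forall>c\<in>inc_hom q x y. \<forall>v\<in>obj M x.
             \<phi> y (mor M x y c v) = mor N x y c (\<phi> x v)))"

definition inc_zero :: "'x rel \<Rightarrow> ('x, 'k, 'v::zero) inc_functor \<Rightarrow> bool" where
  "inc_zero q M \<longleftrightarrow> (\<forall>x\<in>Field q. obj M x = {0})"

text \<open>
  A submodule of \<open>M\<close> is given by its family \<open>U\<close> of subspaces; as a module it is
  \<open>M\<lparr>obj := U\<rparr>\<close>.
\<close>

definition submodule ::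
    "'x rel \<Rightarrow> ('k::field \<Rightarrow> 'v::ab_group_add \<Rightarrow> 'v) \<Rightarrow> ('x, 'k, 'v) inc_functor \<Rightarrow>
     ('x \<Rightarrow> 'v set) \<Rightarrow> bool" where
  "submodule q s M U \<longleftrightarrow>
     (\<forall>x\<in>Field q. U x \<subseteq> obj M x \<and> module.subspace s (U x)) \<and>
     (\<forall>x\<in>Field q. \<forall>y\<in>Field q. \<forall>c\<in>inc_hom q x y. \<forall>u\<in>U x. mor M x y c u \<in> U y)"

text \<open>\<open>M\<close> is the (internal) direct sum of its submodules \<open>U 0, \<dots>, U (k - 1)\<close>.\<close>

definition direct_sum_decomp ::
    "'x rel \<Rightarrow> ('k::field \<Rightarrow> 'v::ab_group_add \<Rightarrow> 'v) \<Rightarrow> ('x, 'k, 'v) inc_functor \<Rightarrow>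
     nat \<Rightarrow> (nat \<Rightarrow> 'x \<Rightarrow> 'v set) \<Rightarrow> bool" where
  "direct_sum_decomp q s M k U \<longleftrightarrow>
     (\<forall>i<k. submodule q s M (U i)) \<and>
     (\<forall>x\<in>Field q. \<forall>v\<in>obj M x.
        \<exists>!u. u \<in> (\<Pi>\<^sub>E i\<in>{..<k}. U i x) \<and> v = (\<Sum>i<k. u i))"

definition indecomposable ::
    "'x rel \<Rightarrow> ('k::field \<Rightarrow> 'v::ab_group_add \<Rightarrow> 'v) \<Rightarrow> ('x, 'k, 'v) inc_functor \<Rightarrow> bool" where
  "indecomposable q s M \<longleftrightarrow>
     \<not> inc_zero q M \<and>
     (\<forall>U. direct_sum_decomp q s M 2 U \<longrightarrow>
        inc_zero q (M\<lparr>obj := U 0\<rparr>) \<or> inc_zero q (M\<lparr>obj := U 1\<rparr>))"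

definition indec_decomp ::
    "'x rel \<Rightarrow> ('k::field \<Rightarrow> 'v::ab_group_add \<Rightarrow> 'v) \<Rightarrow> ('x, 'k, 'v) inc_functor \<Rightarrow>
     nat \<Rightarrow> (nat \<Rightarrow> 'x \<Rightarrow> 'v set) \<Rightarrow> bool" where
  "indec_decomp q s M k U \<longleftrightarrow>
     direct_sum_decomp q s M k U \<and> (\<forall>i<k. indecomposable q s (M\<lparr>obj := U i\<rparr>))"

text \<open>
  The multiplicity of an indecomposable module \<open>X\<close> in an indecomposable decomposition of \<open>M\<close>;
  by Krull-Schmidt such a decomposition exists and the number does not depend on its choice.
\<close>

definition mult_in ::
    "'x rel \<Rightarrow> ('k::field \<Rightarrow> 'w::ab_group_add \<Rightarrow> 'w) \<Rightarrow> ('x, 'k, 'w) inc_functor \<Rightarrow>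
     ('k \<Rightarrow> 'v::ab_group_add \<Rightarrow> 'v) \<Rightarrow> ('x, 'k, 'v) inc_functor \<Rightarrow> nat" where
  "mult_in q t X s M =
     (THE \<mu>. \<exists>k U. indec_decomp q s M k U \<and>
                  \<mu> = card {i. i < k \<and> inc_iso q s (M\<lparr>obj := U i\<rparr>) t X})"

definition compression_mult ::
    "'p rel \<Rightarrow> ('p set \<Rightarrow> 'i rel) \<Rightarrow> ('p set \<Rightarrow> 'i \<Rightarrow> 'p) \<Rightarrow>
     ('k::field \<Rightarrow> 'v::ab_group_add \<Rightarrow> 'v) \<Rightarrow> 'p set \<Rightarrow> ('p, 'k, 'v) inc_functor \<Rightarrow> nat" where
  "compression_mult P Q \<xi> s I M =
     mult_in (Q I) (*) (pullback (\<xi> I) (interval_module P I)) s (pullback (\<xi> I) M)"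


section \<open>Matrices of linear maps\<close>

text \<open>
  The direct sum of the spaces \<open>V c\<close>, \<open>c \<in> C\<close>, consists of functions supported on \<open>C\<close>.
  A matrix assigns a linear map to each pair (row index, column index).  Block rows and block
  columns are formed with sum types: the matrix \<open>[A B]\<close> is \<open>\<lambda>r. case_sum (A r) (B r)\<close>, and
  \<open>A\<close> on top of \<open>B\<close> is \<open>case_sum A B\<close>.
\<close>

definition family_sum :: "'c set \<Rightarrow> ('c \<Rightarrow> 'v::zero set) \<Rightarrow> ('c \<Rightarrow> 'v) set" where
  "family_sum C V = {v. (\<forall>c\<in>C. v c \<in> V c) \<and> (\<forall>c. c \<notin> C \<longrightarrow> v c = 0)}"

definition matrix_map ::
    "'r set \<Rightarrow> 'c set \<Rightarrow> ('r \<Rightarrow> 'c \<Rightarrow> 'v \<Rightarrow> 'v::ab_group_add) \<Rightarrow> ('c \<Rightarrow> 'v) \<Rightarrow> 'r \<Rightarrow> 'v" where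
  "matrix_map R C A v = (\<lambda>r. if r \<in> R then \<Sum>c\<in>C. A r c (v c) else 0)"

definition pointwise_scale :: "('k \<Rightarrow> 'v \<Rightarrow> 'v) \<Rightarrow> 'k \<Rightarrow> ('r \<Rightarrow> 'v) \<Rightarrow> 'r \<Rightarrow> 'v" where
  "pointwise_scale s c v = (\<lambda>r. s c (v r))"

definition matrix_rank ::
    "('k::field \<Rightarrow> 'v::ab_group_add \<Rightarrow> 'v) \<Rightarrow> 'r set \<Rightarrow> 'c set \<Rightarrow> ('c \<Rightarrow> 'v set) \<Rightarrow>
     ('r \<Rightarrow> 'c \<Rightarrow> 'v \<Rightarrow> 'v) \<Rightarrow> nat" where
  "matrix_rank s R C V A =
     lin_rank (pointwise_scale s) (family_sum C V) (matrix_map R C A)"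

text \<open>
  An enumeration \<open>a\<close> of \<open>{a 1, \<dots>, a n}\<close> orders this set by index; \<open>lower\<close> and \<open>upper\<close> pick the
  first and the last element of a subset \<open>A\<close>.
\<close>

definition lower :: "(nat \<Rightarrow> 'a) \<Rightarrow> nat \<Rightarrow> 'a set \<Rightarrow> 'a" where
  "lower a n A = a (Min {i \<in> {1..n}. a i \<in> A})"

definition upper :: "(nat \<Rightarrow> 'a) \<Rightarrow> nat \<Rightarrow> 'a set \<Rightarrow> 'a" where
  "upper a n A = a (Max {i \<in> {1..n}. a i \<in> A})"

abbreviation sc :: "'i rel \<Rightarrow> 'i set" where
  "sc q \<equiv> minimals q (Field q)"

abbreviation sk :: "'i rel \<Rightarrow> 'i set" where
  "sk q \<equiv> maximals q (Field q)"

definition sc1 :: "'i rel \<Rightarrow> ('i set \<times> 'i) set" where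
  "sc1 q = {(A, c). A \<subseteq> sc q \<and> card A = 2 \<and> c \<in> minimals q (\<Inter>x\<in>A. above q x)}"

definition sk1 :: "'i rel \<Rightarrow> ('i set \<times> 'i) set" where
  "sk1 q = {(B, d). B \<subseteq> sk q \<and> card B = 2 \<and> d \<in> maximals q (\<Inter>x\<in>B. under q x)}"

definition M_tilde ::
    "('i \<Rightarrow> 'p) \<Rightarrow> (nat \<Rightarrow> 'i) \<Rightarrow> nat \<Rightarrow> ('p, 'k::field, 'v::ab_group_add) inc_functor \<Rightarrow>
     'i set \<times> 'i \<Rightarrow> 'i \<Rightarrow> 'v \<Rightarrow> 'v" where
  "M_tilde f a n M = (\<lambda>(A, c) x v.
     if x \<notin> A then 0
     else if x = lower a n A then smap M (f c) (f x) v
     else if x = upper a n A then - smap M (f c) (f x) v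
     else 0)"

definition M_hat ::
    "('i \<Rightarrow> 'p) \<Rightarrow> (nat \<Rightarrow> 'i) \<Rightarrow> nat \<Rightarrow> ('p, 'k::field, 'v::ab_group_add) inc_functor \<Rightarrow>
     'i \<Rightarrow> 'i set \<times> 'i \<Rightarrow> 'v \<Rightarrow> 'v" where
  "M_hat f b m M = (\<lambda>y (B, d) v.
     if y \<notin> B then 0
     else if y = lower b m B then smap M (f y) (f d) v
     else if y = upper b m B then - smap M (f y) (f d) v
     else 0)"

text \<open>The lower-left block: the only possibly nonzero entry is at position \<open>(b1, a1)\<close>.\<close>

definition M_corner ::
    "('i \<Rightarrow> 'p) \<Rightarrow> 'i \<Rightarrow> 'i \<Rightarrow> ('p, 'k::field, 'v::ab_group_add) inc_functor \<Rightarrow>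
     'i \<Rightarrow> 'i \<Rightarrow> 'v \<Rightarrow> 'v" where
  "M_corner f b1 a1 M = (\<lambda>y x v.
     if y = b1 \<and> x = a1 then smap M (f b1) (f a1) v else 0)"

definition M_block ::
    "('i \<Rightarrow> 'p) \<Rightarrow> (nat \<Rightarrow> 'i) \<Rightarrow> nat \<Rightarrow> (nat \<Rightarrow> 'i) \<Rightarrow> nat \<Rightarrow>
     ('p, 'k::field, 'v::ab_group_add) inc_functor \<Rightarrow>
     ('i set \<times> 'i) + 'i \<Rightarrow> 'i + ('i set \<times> 'i) \<Rightarrow> 'v \<Rightarrow> 'v" where
  "M_block f a n b m M = case_sum
     (\<lambda>r. case_sum (M_tilde f a n M r)              (\<lambda>_ _. 0))
     (\<lambda>r. case_sum (M_corner f (b 1) (a 1) M r)     (M_hat f b m M r))"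

end

(*
  Over the poset I^xi the module R_I(V_I) is the constant module k, and the multiplicity of k in
  N = R_I(M) is the rank of the canonical map lim N -> colim N.  Indeed lim and colim are additive;
  on a summand isomorphic to k the map is an isomorphism of one-dimensional spaces; and if it is
  nonzero on an indecomposable summand U, an element of lim U together with a functional on colim U
  not killing its image give maps k -> U -> k with composite 1, so that U is isomorphic to k.

  The matrix M_tilde presents lim N as a kernel in the sum over the minimal elements, M_hat presents
  colim N as a cokernel of the sum over the maximal elements, and the lower-left block induces the
  canonical map between them; the rank of the block triangular matrix exceeds
  rank M_tilde + rank M_hat by the rank of the induced map from kernel to cokernel.
*)

theory Submission
  imports Defs
begin

section \<open>Bases of finitely spanned subspaces\<close>

text \<open>No limit or colimit object is constructed. The limit is the space of compatible families
  (\<open>sections\<close>); the colimit, a quotient, is replaced by its dual, the compatible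
  families of functionals (\<open>cocones\<close>). Accordingly the rank of the map from limit to
  colimit is read off without quotients: add to the image of \<open>M_hat\<close> the values of all
  sections at \<open>b 1\<close>, placed in the summand of \<open>b 1\<close>, and take the growth
  in dimension.

  This growth is shown to equal the number of constant summands in an arbitrary indecomposable
  decomposition. Since the growth itself does not mention the decomposition, the definite
  description in \<open>mult_in\<close> is justified by the same identity, together with the
  existence of some decomposition; neither local endomorphism rings nor an exchange argument enter.

  The corner can have a single entry because \<open>a 1\<close> lies below \<open>b 1\<close>: the
  value of a section at \<open>b 1\<close> is the image of its value at \<open>a 1\<close>.

  The ambient space of a representation may have infinite dimension, so the linear algebra is done
  for subspaces contained in a finite span.\<close>

context vector_space
begin

text \<open>Finiteness is the content: an independent set inside the span of the finite
  \<open>B\<close> has at most \<open>card B\<close> elements, whatever the dimension of the ambient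
  space.\<close>

lemma extend_to_finite_basis:
  assumes "finite B" "S \<subseteq> span B" "subspace S" "A \<subseteq> S" "independent A"
  obtains C where "A \<subseteq> C" "C \<subseteq> S" "finite C" "independent C" "span C = S"
proof -
  obtain C where C: "A \<subseteq> C" "C \<subseteq> S" "independent C" "S \<subseteq> span C"
    using maximal_independent_subset_extend[OF assms(4,5)] by blast
  have "finite C"
    using independent_span_bound[OF assms(1) C(3)] C(2) assms(2) by blast
  moreover have "span C = S"
    using C assms(3) span_subspace by blast
  ultimately show thesis
    using C that by blast
qed

lemma obtain_finite_basis:
  assumes "finite B" "S \<subseteq> span B" "subspace S"
  obtains C where "C \<subseteq> S" "finite C" "independent C" "span C = S" "card C = dim S"
proof -
  obtain C where C: "C \<subseteq> S" "finite C" "independent C" "span C = S"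
    using extend_to_finite_basis[OF assms empty_subsetI independent_empty] by blast
  then show thesis
    using that[OF C] dim_span_eq_card_independent[OF C(3)] by simp
qed

text \<open>A basis of \<open>S\<close> extends to a basis of \<open>T\<close>, and the extension is
  proper. The strict inequality drives the descent that splits a module into
  indecomposables.\<close>

lemma subspace_dim_less:
  assumes "finite B" "T \<subseteq> span B" "subspace T" "subspace S" "S \<subseteq> T" "S \<noteq> T"
  shows "dim S < dim T"
proof -
  obtain C where C: "C \<subseteq> S" "finite C" "independent C" "span C = S" "card C = dim S"
    using obtain_finite_basis[of B S] assms by blast
  obtain D where D: "C \<subseteq> D" "D \<subseteq> T" "finite D" "independent D" "span D = T"
    using extend_to_finite_basis[of B T C] assms C by blast
  then have "card C < card D"
    using C(4) assms(6) psubset_card_mono[of D C] by blast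
  then show ?thesis
    using C(4,5) D(5) dim_span_eq_card_independent[OF D(4)] by simp
qed

lemma subspace_dim_mono:
  assumes "finite B" "T \<subseteq> span B" "subspace T" "subspace S" "S \<subseteq> T"
  shows "dim S \<le> dim T"
  using subspace_dim_less[OF assms] by (cases "S = T") auto

text \<open>The functionals \<open>G j\<close> vanish on \<open>H\<close> and are dual to the
  vectors \<open>w j\<close>, so each \<open>w j\<close> adds exactly one dimension. Linearity of
  \<open>G j\<close> on \<open>F\<close> enters in the form that its zero set there is a
  subspace.\<close>

lemma dim_span_dual:
  assumes "finite B" "H \<subseteq> span B" "subspace H" "finite J"
    and G: "\<And>j. j \<in> J \<Longrightarrow> subspace {x \<in> F. G j x = (0::'c::zero_neq_one)}"
    and "H \<subseteq> F" "\<And>j. j \<in> J \<Longrightarrow> w j \<in> F"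
    and GH: "\<And>j h. j \<in> J \<Longrightarrow> h \<in> H \<Longrightarrow> G j h = 0"
    and Gw: "\<And>i j. i \<in> J \<Longrightarrow> j \<in> J \<Longrightarrow> G j (w i) = (if i = j then 1 else 0)"
  shows "dim (span (H \<union> w ` J)) = dim H + card J"
proof -
  obtain C where C: "C \<subseteq> H" "finite C" "independent C" "span C = H" "card C = dim H"
    using obtain_finite_basis[OF assms(1-3)] by blast
  have *: "finite K \<Longrightarrow> K \<subseteq> J \<Longrightarrow> independent (C \<union> w ` K) \<and> card (C \<union> w ` K) = dim H + card K" for K
  proof (induction K rule: finite_induct)
    case empty
    then show ?case using C by simp
  next
    case (insert j K)
    \<comment> \<open>All vectors collected so far are killed by \<open>G j\<close>, whereas
      \<open>w j\<close> is not.\<close>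
    let ?Z = "{x \<in> F. G j x = 0}"
    have "C \<union> w ` K \<subseteq> ?Z"
      using C(1) assms(6,7) GH[of j] Gw[of _ j] insert by auto
    moreover have "subspace ?Z"
      using G insert.prems by blast
    ultimately have "span (C \<union> w ` K) \<subseteq> ?Z"
      by (rule span_minimal)
    moreover have "w j \<notin> ?Z"
      using Gw[of j j] insert.prems by auto
    ultimately have n: "w j \<notin> span (C \<union> w ` K)"
      by (rule contra_subsetD)
    then have n': "w j \<notin> C \<union> w ` K"
      using span_superset by (rule contra_subsetD[rotated])
    have IH: "independent (C \<union> w ` K)" "card (C \<union> w ` K) = dim H + card K"
      using insert.IH insert.prems by blast+
    have eq: "C \<union> w ` insert j K = insert (w j) (C \<union> w ` K)"
      by simp
    show ?case
      unfolding eq using independent_insertI[OF n IH(1)] IH(2) n' C(2) insert.hyps by simp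
  qed
  have "span (H \<union> w ` J) = span (C \<union> w ` J)"
    unfolding span_Un C(4) using assms(3) by (simp add: span_eq_iff[THEN iffD2])
  then show ?thesis
    using *[OF assms(4) subset_refl] dim_span_eq_card_independent[of "C \<union> w ` J"] by simp
qed

end

section \<open>Dimensions of images of finitely spanned subspaces\<close>

context vector_space_pair
begin

text \<open>A basis \<open>A\<close> of the kernel on \<open>W\<close> is extended to a basis
  \<open>C\<close> of \<open>W\<close>; the images of \<open>C - A\<close> then form a basis of the
  image.\<close>

lemma rank_nullity_on:
  assumes f: "Vector_Spaces.linear s1 s2 f" and "finite B" "W \<subseteq> vs1.span B" "vs1.subspace W"
  shows "vs1.dim W = vs2.dim (f ` W) + vs1.dim {x \<in> W. f x = 0}"
proof -
  let ?K = "{x \<in> W. f x = 0}"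
  have K: "vs1.subspace ?K"
    using vs1.subspace_inter[OF assms(4) linear_subspace_kernel[OF f]] by (simp add: Collect_conj_eq)
  obtain A where A: "A \<subseteq> ?K" "finite A" "vs1.independent A" "vs1.span A = ?K" "card A = vs1.dim ?K"
    using vs1.obtain_finite_basis[OF assms(2) _ K] assms(3) by blast
  obtain C where C: "A \<subseteq> C" "C \<subseteq> W" "finite C" "vs1.independent C" "vs1.span C = W"
    using vs1.extend_to_finite_basis[OF assms(2-4) _ A(3)] A(1) by blast
  let ?D = "C - A"
  have D: "vs1.independent ?D"
    using C(4) vs1.independent_mono by blast
  \<comment> \<open>Such a \<open>z\<close> lies in the span of \<open>A\<close> as well as in that
    of the complement \<open>?D\<close>. Both expansions agree with the one over \<open>C\<close>,
    so no basis vector can have a nonzero coefficient.\<close>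
  have "z = 0" if z: "z \<in> vs1.span ?D" "f z = 0" for z
  proof -
    have zC: "z \<in> vs1.span C"
      using z(1) vs1.span_mono[of ?D C] by blast
    then have zA: "z \<in> vs1.span A"
      using z(2) C(5) A(4) by blast
    have "vs1.representation C z = vs1.representation ?D z"
      using vs1.representation_extend[OF C(4) z(1)] by blast
    moreover have "vs1.representation C z = vs1.representation A z"
      using vs1.representation_extend[OF C(4) zA] C(1) by blast
    ultimately have "vs1.representation C z b = 0" for b
      using vs1.representation_ne_zero[of A z b] vs1.representation_ne_zero[of ?D z b] by (metis DiffD2)
    then show ?thesis
      using vs1.sum_nonzero_representation_eq[OF C(4) zC] by simp
  qed
  then have inj: "inj_on f (vs1.span ?D)"
    using linear_inj_on_iff_eq_0[OF f vs1.subspace_span] by blast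
  then have ind: "vs2.independent (f ` ?D)"
    using linear_independent_injective_image[OF f D] by blast
  have "f ` W = vs2.span (f ` C)"
    using linear_span_image[OF f] C(5) by simp
  also have "\<dots> = vs2.span (f ` ?D)"
  proof
    have "f x \<in> vs2.span (f ` ?D)" if "x \<in> C" for x
    proof (cases "x \<in> A")
      case True
      then have "f x = 0" using A(1) by blast
      then show ?thesis by (simp add: vs2.span_zero)
    next
      case False
      with that show ?thesis by (intro vs2.span_base) simp
    qed
    then show "vs2.span (f ` C) \<subseteq> vs2.span (f ` ?D)"
      by (intro vs2.span_minimal) auto
    show "vs2.span (f ` ?D) \<subseteq> vs2.span (f ` C)"
      by (intro vs2.span_mono) blast
  qed
  finally have "vs2.dim (f ` W) = card (f ` ?D)"
    using vs2.dim_span_eq_card_independent[OF ind] by simp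
  also have "\<dots> = card ?D"
    using inj_on_subset[OF inj vs1.span_superset] by (rule card_image)
  finally have "vs2.dim (f ` W) = card ?D" .
  moreover have "vs1.dim W = card C"
    using vs1.dim_span_eq_card_independent[OF C(4)] C(5) by simp
  moreover have "card C = card ?D + card A"
    using card_Diff_subset[OF A(2) C(1)] card_mono[OF C(3,1)] by simp
  ultimately show ?thesis
    using A(5) by simp
qed

lemma dim_inj_image:
  assumes "Vector_Spaces.linear s1 s2 f" "inj_on f W" "finite B" "W \<subseteq> vs1.span B" "vs1.subspace W"
  shows "vs2.dim (f ` W) = vs1.dim W"
proof -
  have "{x \<in> W. f x = 0} = {0}"
    using inj_onD[OF assms(2), of _ 0] linear_0[OF assms(1)] vs1.subspace_0[OF assms(5)] by auto
  moreover have "vs1.dim {0} = 0"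
    using vs1.dim_le_card[of "{0}" "{}"] by simp
  ultimately show ?thesis
    using rank_nullity_on[OF assms(1,3,4,5)] by simp
qed

end

section \<open>Ranks of block matrices\<close>

lemma vector_space_pointwise_scale:
  assumes "vector_space s"
  shows "vector_space (pointwise_scale s)"
proof -
  interpret vector_space s by fact
  show ?thesis
    by unfold_locales (auto simp: pointwise_scale_def fun_eq_iff algebra_simps)
qed

lemma fin_dim_subspace:
  assumes "vector_space s" "fin_dim s V"
  shows "module.subspace s V"
proof -
  interpret vector_space s by fact
  show ?thesis
    using assms(2) unfolding fin_dim_def by auto
qed

lemma linear_between_zero:
  assumes "vector_space s" "module.subspace s V" "linear_between s V t W f"
  shows "f 0 = 0"
proof -
  interpret vector_space s by fact
  have "f (0 + 0) = f 0 + f 0"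
    using assms(3) subspace_0[OF assms(2)] unfolding linear_between_def by blast
  then show ?thesis by simp
qed

lemma linear_between_sum:
  assumes "vector_space s" "module.subspace s V" "linear_between s V t W f"
    and "\<And>j. j \<in> J \<Longrightarrow> g j \<in> V"
  shows "f (\<Sum>j\<in>J. g j) = (\<Sum>j\<in>J. f (g j))"
proof -
  interpret vector_space s by fact
  show ?thesis
    using assms(4)
  proof (induction J rule: infinite_finite_induct)
    case (insert j J)
    then have "(\<Sum>j\<in>J. g j) \<in> V"
      by (intro subspace_sum[OF assms(2)]) simp
    then show ?case
      using insert assms(3) unfolding linear_between_def by simp
  qed (simp_all add: linear_between_zero[OF assms(1-3)])
qed

lemma linear_between_image_subspace:
  assumes "vector_space s" "vector_space t" "module.subspace s V" "linear_between s V t W f"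
  shows "module.subspace t (f ` V)"
proof -
  interpret s: vector_space s by fact
  interpret t: vector_space t by fact
  show ?thesis
  proof (rule t.subspaceI)
    show "0 \<in> f ` V"
      using linear_between_zero[OF assms(1,3,4)] s.subspace_0[OF assms(3)] by (metis image_eqI)
  next
    fix x y assume "x \<in> f ` V" "y \<in> f ` V"
    then obtain u v where "u \<in> V" "v \<in> V" "x = f u" "y = f v" by blast
    then have "x + y = f (u + v)" "u + v \<in> V"
      using assms(4) s.subspace_add[OF assms(3)] unfolding linear_between_def by auto
    then show "x + y \<in> f ` V" by blast
  next
    fix c x assume "x \<in> f ` V"
    then obtain u where "u \<in> V" "x = f u" by blast
    then have "t c x = f (s c u)" "s c u \<in> V"
      using assms(4) s.subspace_scale[OF assms(3)] unfolding linear_between_def by auto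
    then show "t c x \<in> f ` V" by blast
  qed
qed

text \<open>The inclusion of the summand with index \<open>c\<close> into a direct sum.\<close>

definition single_at :: "'c \<Rightarrow> 'v \<Rightarrow> 'c \<Rightarrow> 'v::zero" where
  "single_at c v = (\<lambda>x. if x = c then v else 0)"

lemma single_at_zero [simp]: "single_at c 0 = 0"
  by (simp add: single_at_def fun_eq_iff)

lemma linear_single_at:
  fixes s :: "'k::field \<Rightarrow> 'v::ab_group_add \<Rightarrow> 'v"
  assumes "vector_space s"
  shows "Vector_Spaces.linear s (pointwise_scale s) (single_at (c :: 'c))"
proof -
  interpret vector_space s by fact
  interpret p: vector_space "pointwise_scale s :: 'k \<Rightarrow> ('c \<Rightarrow> 'v) \<Rightarrow> 'c \<Rightarrow> 'v"
    using assms by (rule vector_space_pointwise_scale)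
  show ?thesis
    by unfold_locales (auto simp: single_at_def pointwise_scale_def fun_eq_iff)
qed

lemma single_at_in_family_sum:
  assumes "\<And>c. c \<in> C \<Longrightarrow> (0::'v::zero) \<in> V c" "d \<in> C" "v \<in> V d"
  shows "single_at d v \<in> family_sum C V"
  using assms by (auto simp: single_at_def family_sum_def)

lemma family_sum_eq_sum_single_at:
  assumes "finite C" "v \<in> family_sum C V"
  shows "v = (\<Sum>c\<in>C. single_at c (v c :: 'v::comm_monoid_add))"
proof
  fix x
  have "(\<Sum>c\<in>C. single_at c (v c)) x = (\<Sum>c\<in>C. single_at c (v c) x)"
    using assms(1) by induction auto
  also have "\<dots> = v x"
    using assms by (simp add: single_at_def family_sum_def)
  finally show "v x = (\<Sum>c\<in>C. single_at c (v c)) x" ..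
qed

lemma subspace_family_sum:
  fixes s :: "'k::field \<Rightarrow> 'v::ab_group_add \<Rightarrow> 'v"
  assumes "vector_space s" "\<And>c. c \<in> C \<Longrightarrow> module.subspace s (V c)"
  shows "module.subspace (pointwise_scale s) (family_sum (C :: 'c set) V)"
proof -
  interpret vector_space s by fact
  interpret p: vector_space "pointwise_scale s :: 'k \<Rightarrow> ('c \<Rightarrow> 'v) \<Rightarrow> 'c \<Rightarrow> 'v"
    using assms(1) by (rule vector_space_pointwise_scale)
  show ?thesis
    using assms(2) subspace_0 subspace_add subspace_scale
    by (intro p.subspaceI) (auto simp: family_sum_def pointwise_scale_def)
qed

text \<open>The inclusions of the summands carry finite spanning sets of the \<open>V c\<close> to a
  finite set that spans the direct sum.\<close>

lemma family_sum_finitely_spanned: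
  fixes s :: "'k::field \<Rightarrow> 'v::ab_group_add \<Rightarrow> 'v"
  assumes "vector_space s" "finite (C :: 'c set)" "\<And>c. c \<in> C \<Longrightarrow> fin_dim s (V c)"
  obtains B where "finite B" "family_sum C V \<subseteq> module.span (pointwise_scale s) B"
proof -
  interpret vector_space s by fact
  interpret p: vector_space "pointwise_scale s :: 'k \<Rightarrow> ('c \<Rightarrow> 'v) \<Rightarrow> 'c \<Rightarrow> 'v"
    using assms(1) by (rule vector_space_pointwise_scale)
  interpret vector_space_pair s "pointwise_scale s :: 'k \<Rightarrow> ('c \<Rightarrow> 'v) \<Rightarrow> 'c \<Rightarrow> 'v" ..
  obtain E where E: "\<And>c. c \<in> C \<Longrightarrow> finite (E c) \<and> V c = span (E c)"
    using assms(3) unfolding fin_dim_def by metis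
  let ?B = "\<Union>c\<in>C. single_at c ` E c"
  have "single_at c x \<in> p.span ?B" if "c \<in> C" "x \<in> V c" for c x
  proof -
    have "single_at c x \<in> single_at c ` span (E c)"
      using E that by blast
    also have "\<dots> = p.span (single_at c ` E c)"
      using linear_span_image[OF linear_single_at[OF assms(1)]] by simp
    also have "\<dots> \<subseteq> p.span ?B"
      using that(1) by (intro p.span_mono) blast
    finally show ?thesis .
  qed
  then have "v \<in> p.span ?B" if "v \<in> family_sum C V" for v
    using that
    by (subst family_sum_eq_sum_single_at[OF assms(2) that])
      (intro p.span_sum, simp add: family_sum_def)
  then show thesis
    using that[of ?B] E assms(2) by blast
qed

lemma matrix_map_linear_between:
  assumes "vector_space s" "\<And>r. r \<in> R \<Longrightarrow> module.subspace s (W r)"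
    and A: "\<And>r c. r \<in> R \<Longrightarrow> c \<in> C \<Longrightarrow> linear_between s (V c) s (W r) (A r c)"
  shows "linear_between (pointwise_scale s) (family_sum C V)
     (pointwise_scale s) (family_sum R W) (matrix_map R C A)"
proof -
  interpret vector_space s by fact
  show ?thesis
    unfolding linear_between_def
  proof (intro conjI ballI allI)
    fix v assume v: "v \<in> family_sum C V"
    have "(\<Sum>c\<in>C. A r c (v c)) \<in> W r" if "r \<in> R" for r
      using A v that by (intro subspace_sum[OF assms(2)]) (auto simp: family_sum_def linear_between_def)
    then show "matrix_map R C A v \<in> family_sum R W"
      by (simp add: matrix_map_def family_sum_def)
    fix u assume u: "u \<in> family_sum C V"
    have "A r c (v c + u c) = A r c (v c) + A r c (u c)" if "r \<in> R" "c \<in> C" for r c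
      using A[OF that] u v that by (simp add: family_sum_def linear_between_def)
    then show "matrix_map R C A (v + u) = matrix_map R C A v + matrix_map R C A u"
      by (simp add: matrix_map_def fun_eq_iff flip: sum.distrib)
  next
    fix e v assume v: "v \<in> family_sum C V"
    have "A r c (s e (v c)) = s e (A r c (v c))" if "r \<in> R" "c \<in> C" for r c
      using A[OF that] v that by (simp add: family_sum_def linear_between_def)
    then show "matrix_map R C A (pointwise_scale s e v) = pointwise_scale s e (matrix_map R C A v)"
      by (simp add: matrix_map_def pointwise_scale_def fun_eq_iff scale_sum_right)
  qed
qed

lemma mem_Plus_iff [simp]: "Inl c \<in> C <+> D \<longleftrightarrow> c \<in> C" "Inr d \<in> C <+> D \<longleftrightarrow> d \<in> D"
  by auto

text \<open>A vector indexed by a disjoint union is a pair of vectors, with \<open>case_sum\<close>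
  as pairing; block matrices can thus be evaluated on pairs.\<close>

lemma family_sum_Plus:
  "family_sum (C <+> D) (case_sum V W) =
     {case_sum v w |v w. v \<in> family_sum C V \<and> w \<in> family_sum D W}" (is "?L = ?R")
proof
  show "?L \<subseteq> ?R"
  proof
    fix z assume z: "z \<in> ?L"
    have "z = case_sum (\<lambda>c. z (Inl c)) (\<lambda>d. z (Inr d))"
      by (rule ext) (simp split: sum.split)
    moreover have "(\<lambda>c. z (Inl c)) \<in> family_sum C V" "(\<lambda>d. z (Inr d)) \<in> family_sum D W"
      using z unfolding family_sum_def mem_Collect_eq
      by (metis (no_types) mem_Plus_iff(1) sum.case(1), metis (no_types) mem_Plus_iff(2) sum.case(2))
    ultimately show "z \<in> ?R" by blast
  qed
  show "?R \<subseteq> ?L"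
    by (auto simp: family_sum_def split: sum.split)
qed

lemma family_sum_empty: "family_sum {} V = {0}"
  by (auto simp: family_sum_def fun_eq_iff)

lemma matrix_map_block:
  assumes "finite C" "finite D"
  shows "matrix_map (R <+> S) (C <+> D)
      (case_sum (\<lambda>r. case_sum (X r) (\<lambda>_ _. 0)) (\<lambda>r. case_sum (Y r) (Z r))) (case_sum v w) =
    case_sum (matrix_map R C X v) (matrix_map S C Y v + matrix_map S D Z w)"
  by (rule ext) (auto simp: matrix_map_def sum.Plus[OF assms] split: sum.split)

text \<open>Rank and nullity of the projection of the image onto the upper rows: what is seen there
  is the image of \<open>X\<close>, and what is lost consists of the lower parts of those pairs
  whose \<open>v\<close> satisfies \<open>X v = 0\<close>.\<close>

lemma matrix_rank_block:
  fixes s :: "'k::field \<Rightarrow> 'v::ab_group_add \<Rightarrow> 'v"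
    and R :: "'r set" and S :: "'s set" and C :: "'c set" and D :: "'d set"
  assumes s: "vector_space s"
    and fin: "finite R" "finite S" "finite C" "finite D"
    and V: "\<And>c. c \<in> C \<Longrightarrow> fin_dim s (V c)" "\<And>d. d \<in> D \<Longrightarrow> fin_dim s (V' d)"
    and W: "\<And>r. r \<in> R \<Longrightarrow> fin_dim s (W r)" "\<And>r. r \<in> S \<Longrightarrow> fin_dim s (W' r)"
    and X: "\<And>r c. r \<in> R \<Longrightarrow> c \<in> C \<Longrightarrow> linear_between s (V c) s (W r) (X r c)"
    and Y: "\<And>r c. r \<in> S \<Longrightarrow> c \<in> C \<Longrightarrow> linear_between s (V c) s (W' r) (Y r c)"
    and Z: "\<And>r d. r \<in> S \<Longrightarrow> d \<in> D \<Longrightarrow> linear_between s (V' d) s (W' r) (Z r d)"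
  shows "matrix_rank s (R <+> S) (C <+> D) (case_sum V V')
      (case_sum (\<lambda>r. case_sum (X r) (\<lambda>_ _. 0)) (\<lambda>r. case_sum (Y r) (Z r))) =
    matrix_rank s R C V X +
    vector_space.dim (pointwise_scale s)
      {matrix_map S C Y v + matrix_map S D Z w |v w.
         v \<in> family_sum C V \<and> matrix_map R C X v = 0 \<and> w \<in> family_sum D V'}"
    (is "matrix_rank s _ _ ?V ?A = _ + vector_space.dim _ ?D")
proof -
  interpret vector_space s by fact
  interpret p: vector_space "pointwise_scale s :: 'k \<Rightarrow> ('r \<Rightarrow> 'v) \<Rightarrow> 'r \<Rightarrow> 'v"
    using s by (rule vector_space_pointwise_scale)
  interpret q: vector_space "pointwise_scale s :: 'k \<Rightarrow> ('s \<Rightarrow> 'v) \<Rightarrow> 's \<Rightarrow> 'v"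
    using s by (rule vector_space_pointwise_scale)
  interpret b: vector_space "pointwise_scale s :: 'k \<Rightarrow> ('r + 's \<Rightarrow> 'v) \<Rightarrow> 'r + 's \<Rightarrow> 'v"
    using s by (rule vector_space_pointwise_scale)
  interpret c: vector_space "pointwise_scale s :: 'k \<Rightarrow> ('c + 'd \<Rightarrow> 'v) \<Rightarrow> 'c + 'd \<Rightarrow> 'v"
    using s by (rule vector_space_pointwise_scale)
  interpret bp: vector_space_pair "pointwise_scale s :: 'k \<Rightarrow> ('r + 's \<Rightarrow> 'v) \<Rightarrow> 'r + 's \<Rightarrow> 'v"
    "pointwise_scale s :: 'k \<Rightarrow> ('r \<Rightarrow> 'v) \<Rightarrow> 'r \<Rightarrow> 'v" ..
  interpret bq: vector_space_pair "pointwise_scale s :: 'k \<Rightarrow> ('r + 's \<Rightarrow> 'v) \<Rightarrow> 'r + 's \<Rightarrow> 'v"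
    "pointwise_scale s :: 'k \<Rightarrow> ('s \<Rightarrow> 'v) \<Rightarrow> 's \<Rightarrow> 'v" ..
  let ?M = "matrix_map (R <+> S) (C <+> D) ?A ` family_sum (C <+> D) ?V"
  have zero: "linear_between s U s U' (\<lambda>_. 0)" if "fin_dim s U'" for U U'
    using subspace_0[OF fin_dim_subspace[OF s that]] by (simp add: linear_between_def)
  have lin: "linear_between (pointwise_scale s) (family_sum (C <+> D) ?V)
     (pointwise_scale s) (family_sum (R <+> S) (case_sum W W')) (matrix_map (R <+> S) (C <+> D) ?A)"
    using W X Y Z zero fin_dim_subspace[OF s] by (intro matrix_map_linear_between[OF s]) auto
  have subV: "c.subspace (family_sum (C <+> D) ?V)"
    using V fin_dim_subspace[OF s] by (intro subspace_family_sum[OF s]) auto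
  have subM: "b.subspace ?M"
    by (rule linear_between_image_subspace[OF _ _ subV lin]) unfold_locales
  have "fin_dim s (case_sum W W' r)" if "r \<in> R <+> S" for r
    using that W by auto
  then obtain B where "finite B" "family_sum (R <+> S) (case_sum W W') \<subseteq> b.span B"
    using family_sum_finitely_spanned[OF s finite_Plus[OF fin(1,2)]] by metis
  moreover have "?M \<subseteq> family_sum (R <+> S) (case_sum W W')"
    using lin by (auto simp: linear_between_def)
  ultimately have B: "finite B" "?M \<subseteq> b.span B"
    by blast+
  have M: "?M = {case_sum (matrix_map R C X v) (matrix_map S C Y v + matrix_map S D Z w) |v w.
      v \<in> family_sum C V \<and> w \<in> family_sum D V'}"
    unfolding family_sum_Plus matrix_map_block[OF fin(3,4), symmetric] by blast
  \<comment> \<open>\<open>?\<pi>\<close> keeps the upper rows, \<open>?\<iota>\<close> inserts a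
    vector into the lower rows, and \<open>?\<rho>\<close> below recovers it.\<close>
  let ?\<pi> = "\<lambda>z :: 'r + 's \<Rightarrow> 'v. \<lambda>r. z (Inl r)"
  let ?\<iota> = "\<lambda>z :: 's \<Rightarrow> 'v. case_sum (0 :: 'r \<Rightarrow> 'v) z"
  have \<pi>: "Vector_Spaces.linear (pointwise_scale s) (pointwise_scale s) ?\<pi>"
    by unfold_locales (auto simp: pointwise_scale_def)
  let ?\<rho> = "\<lambda>z :: 'r + 's \<Rightarrow> 'v. \<lambda>r. z (Inr r)"
  have \<rho>: "Vector_Spaces.linear (pointwise_scale s) (pointwise_scale s) ?\<rho>"
    by unfold_locales (auto simp: pointwise_scale_def)
  \<comment> \<open>Every \<open>v\<close> needs some partner \<open>w\<close> for its image under
    \<open>X\<close> to occur in the projection; \<open>0\<close> serves.\<close>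
  have "0 \<in> family_sum D V'"
    using V(2) fin_dim_subspace[OF s] subspace_0 by (auto simp: family_sum_def)
  then have "?\<pi> ` ?M = matrix_map R C X ` family_sum C V"
    unfolding M by (auto simp: image_iff) (metis sum.case(1))
  moreover have K: "{z \<in> ?M. ?\<pi> z = 0} = ?\<iota> ` ?D"
  proof -
    have "?\<iota> ` ?D = {case_sum 0 (matrix_map S C Y v + matrix_map S D Z w) |v w.
        v \<in> family_sum C V \<and> matrix_map R C X v = 0 \<and> w \<in> family_sum D V'}"
      by blast
    also have "\<dots> = {z \<in> ?M. ?\<pi> z = 0}"
      unfolding M by (auto; metis)
    finally show ?thesis ..
  qed
  moreover have "b.dim ?M = p.dim (?\<pi> ` ?M) + b.dim {z \<in> ?M. ?\<pi> z = 0}"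
    by (rule bp.rank_nullity_on[OF \<pi> B subM])
  moreover have "q.dim (?\<rho> ` {z \<in> ?M. ?\<pi> z = 0}) = b.dim {z \<in> ?M. ?\<pi> z = 0}"
  proof (rule bq.dim_inj_image[OF \<rho> _ B(1)])
    show "inj_on ?\<rho> {z \<in> ?M. ?\<pi> z = 0}"
      by (rule inj_onI) (simp add: fun_eq_iff split_sum_all)
    show "b.subspace {z \<in> ?M. ?\<pi> z = 0}"
      using b.subspace_inter[OF subM bp.linear_subspace_kernel[OF \<pi>]] by (simp add: Collect_conj_eq)
  qed (use B(2) in blast)
  moreover have "?\<rho> ` ?\<iota> ` ?D = ?D"
    by (simp add: image_image)
  ultimately show ?thesis
    by (simp add: matrix_rank_def lin_rank_def)
qed

section \<open>Finite posets and modules over them\<close>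

lemma vector_space_field_mult: "vector_space ((*) :: 'k::field \<Rightarrow> 'k \<Rightarrow> 'k)"
  by unfold_locales (auto simp: algebra_simps)

text \<open>Since \<open>x\<close> lies outside \<open>H\<close>, it extends a basis of
  \<open>H\<close> to a larger independent set; \<open>g\<close> is the coordinate at
  \<open>x\<close>. This gives functionals on a quotient by \<open>H\<close> without forming the
  quotient.\<close>

lemma exists_functional:
  assumes "vector_space (s :: 'k::field \<Rightarrow> 'v::ab_group_add \<Rightarrow> 'v)" "module.subspace s H" "x \<notin> H"
  obtains g where "Vector_Spaces.linear s (*) g" "g x = 1" "\<And>h. h \<in> H \<Longrightarrow> g h = 0"
proof -
  interpret s: vector_space s by fact
  interpret vector_space "(*) :: 'k \<Rightarrow> 'k \<Rightarrow> 'k" by (rule vector_space_field_mult)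
  interpret vector_space_pair s "(*) :: 'k \<Rightarrow> 'k \<Rightarrow> 'k" ..
  obtain C where C: "C \<subseteq> H" "s.independent C" "H \<subseteq> s.span C"
    using s.maximal_independent_subset[of H] by blast
  have H: "s.span C = H"
    using s.span_subspace[OF C(1,3) assms(2)] .
  have ind: "s.independent (insert x C)"
    using s.independent_insertI[OF _ C(2), of x] assms(3) H by simp
  obtain g where g: "Vector_Spaces.linear s (*) g" "\<forall>v\<in>insert x C. g v = (if v = x then 1 else 0)"
    using linear_independent_extend[OF ind, of "\<lambda>v. if v = x then 1 else 0"] by blast
  have "g h = 0" if "h \<in> H" for h
  proof (rule linear_eq_0_on_span[OF g(1)])
    show "h \<in> s.span C" using that H by simp
    show "g v = 0" if "v \<in> C" for v
      using that C(1) assms(3) g(2) by auto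
  qed
  then show thesis
    using that g by simp
qed

section \<open>Finite posets: extremal elements, connectedness, enumerations\<close>

lemma Partial_order_refl: "Partial_order q \<Longrightarrow> x \<in> Field q \<Longrightarrow> (x, x) \<in> q"
  by (simp add: partial_order_on_def preorder_on_def refl_on_def)

lemma Partial_order_trans: "Partial_order q \<Longrightarrow> (x, y) \<in> q \<Longrightarrow> (y, z) \<in> q \<Longrightarrow> (x, z) \<in> q"
  unfolding partial_order_on_def preorder_on_def by (metis transD)

lemma Partial_order_antisym: "Partial_order q \<Longrightarrow> (x, y) \<in> q \<Longrightarrow> (y, x) \<in> q \<Longrightarrow> x = y"
  unfolding partial_order_on_def by (metis antisymD)

text \<open>Descent on the number of elements of \<open>S\<close> below \<open>x\<close>: an element
  that is not minimal has a strictly smaller one, and antisymmetry removes \<open>x\<close> from the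
  set counted.\<close>

lemma minimal_below:
  assumes "Partial_order q" "finite S" "S \<subseteq> Field q" "x \<in> S"
  shows "\<exists>c\<in>minimals q S. (c, x) \<in> q"
  using assms(2,4)
proof (induction "card {y \<in> S. (y, x) \<in> q}" arbitrary: x rule: less_induct)
  case less
  show ?case
  proof (cases "x \<in> minimals q S")
    case True
    then show ?thesis
      using Partial_order_refl[OF assms(1), of x] assms(3) less.prems by blast
  next
    case False
    then obtain y where y: "y \<in> S" "(y, x) \<in> q" "y \<noteq> x"
      using less.prems by (auto simp: minimals_def)
    have "{z \<in> S. (z, y) \<in> q} \<subseteq> {z \<in> S. (z, x) \<in> q}"
      using Partial_order_trans[OF assms(1) _ y(2)] by blast
    moreover have "x \<in> {z \<in> S. (z, x) \<in> q}"
      using Partial_order_refl[OF assms(1)] assms(3) less.prems by blast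
    moreover have "x \<notin> {z \<in> S. (z, y) \<in> q}"
      using Partial_order_antisym[OF assms(1) y(2)] y(3) by blast
    ultimately have "card {z \<in> S. (z, y) \<in> q} < card {z \<in> S. (z, x) \<in> q}"
      using less.prems(1) by (intro psubset_card_mono) auto
    then obtain c where "c \<in> minimals q S" "(c, y) \<in> q"
      using less.hyps less.prems(1) y(1) by blast
    then show ?thesis
      using Partial_order_trans[OF assms(1) _ y(2)] by blast
  qed
qed

lemma maximal_above:
  assumes "Partial_order q" "finite S" "S \<subseteq> Field q" "x \<in> S"
  shows "\<exists>c\<in>maximals q S. (x, c) \<in> q"
proof -
  have "maximals q S = minimals (q\<inverse>) S"
    by (auto simp: maximals_def minimals_def)
  then show ?thesis
    using minimal_below[of "q\<inverse>" S x] assms by (simp add: Field_converse)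
qed

lemma poset_connected_constant:
  assumes "poset_connected q (Field q)" "\<And>x y. (x, y) \<in> q \<Longrightarrow> f x = f y"
    and "x \<in> Field q" "y \<in> Field q"
  shows "f x = f y"
proof -
  have "(x, y) \<in> ((q \<union> q\<inverse>) \<inter> Field q \<times> Field q)\<^sup>*"
    using assms unfolding poset_connected_def by blast
  then show ?thesis
  proof (induction rule: rtrancl_induct)
    case (step y z)
    then have "f y = f z" using assms(2) by auto
    then show ?case using step.IH by simp
  qed simp
qed

text \<open>Guarantees that the positive and the negative sign in a row of \<open>M_tilde\<close> or
  a column of \<open>M_hat\<close> fall on two different positions, which exhaust the two-element
  set.\<close>

lemma lower_upper:
  assumes "bij_betw a {1..n} S" "A \<subseteq> S" "card A = 2"
  shows "A = {lower a n A, upper a n A}" "lower a n A \<noteq> upper a n A"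
proof -
  obtain x y where A: "A = {x, y}" "x \<noteq> y"
    using assms(3) by (auto simp: card_2_iff)
  obtain i j where ij: "i \<in> {1..n}" "j \<in> {1..n}" "x = a i" "y = a j"
    using assms(1,2) A by (auto simp: bij_betw_def)
  have "{l \<in> {1..n}. a l \<in> A} = {i, j}"
  proof -
    have "a l = x \<longleftrightarrow> l = i" "a l = y \<longleftrightarrow> l = j" if "l \<in> {1..n}" for l
      using ij that bij_betw_imp_inj_on[OF assms(1)] by (metis inj_onD)+
    then show ?thesis
      unfolding A(1) using ij(1,2) by blast
  qed
  moreover have "i \<noteq> j"
    using A ij by blast
  ultimately have "lower a n A = a (min i j)" "upper a n A = a (max i j)"
    by (simp_all add: lower_def upper_def)
  then show "A = {lower a n A, upper a n A}" "lower a n A \<noteq> upper a n A"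
    using A ij by (auto simp: min_def max_def)
qed

text \<open>A finite-dimensional representation of a finite poset. The locale is meant for reuse: it
  is interpreted for the pulled-back module over the compressed poset and, inside proofs, for the
  summands of a decomposition.\<close>

locale incidence_rep =
  fixes q :: "'x rel" and s :: "'k::field \<Rightarrow> 'v::ab_group_add \<Rightarrow> 'v"
    and N :: "('x, 'k, 'v) inc_functor"
  assumes po: "Partial_order q" and finite_Field: "finite (Field q)"
    and inc_module: "inc_module q s N"
begin

sublocale vector_space s
  using inc_module by (simp add: inc_module_def)

lemma fin_dim_obj: "x \<in> Field q \<Longrightarrow> fin_dim s (obj N x)"
  using inc_module by (simp add: inc_module_def)

lemma subspace_obj: "x \<in> Field q \<Longrightarrow> subspace (obj N x)"
  using fin_dim_obj fin_dim_subspace vector_space_axioms by blast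

text \<open>Reduces the action of a whole hom space to the structure map. If \<open>x\<close> is not
  below \<open>y\<close>, then \<open>c\<close> is \<open>0\<close>, and both sides vanish whatever
  value \<open>smap N y x\<close> has there.\<close>

lemma mor_eq_scale_smap:
  assumes "x \<in> Field q" "y \<in> Field q" "c \<in> inc_hom q x y" "v \<in> obj N x"
  shows "mor N x y c v = s c (smap N y x v)"
proof -
  have *: "\<forall>e. \<forall>d\<in>inc_hom q x y. mor N x y (e * d) v = s e (mor N x y d v)"
    using inc_module assms unfolding inc_module_def by blast
  show ?thesis
  proof (cases "(x, y) \<in> q")
    case True
    then show ?thesis
      using *[rule_format, of 1 c] by (simp add: inc_hom_def smap_def)
  next
    case False
    then show ?thesis
      using *[rule_format, of 0 0] assms(3) by (simp add: inc_hom_def)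
  qed
qed

lemma linear_mor:
  "x \<in> Field q \<Longrightarrow> y \<in> Field q \<Longrightarrow> c \<in> inc_hom q x y \<Longrightarrow>
    linear_between s (obj N x) s (obj N y) (mor N x y c)"
  using inc_module by (simp add: inc_module_def)

lemma linear_smap:
  assumes "(x, y) \<in> q"
  shows "linear_between s (obj N x) s (obj N y) (smap N y x)"
proof -
  have "(1::'k) \<in> inc_hom q x y" "x \<in> Field q" "y \<in> Field q"
    using assms by (auto simp: inc_hom_def Field_def)
  then show ?thesis
    unfolding smap_def by (intro linear_mor)
qed

lemma smap_id: "x \<in> Field q \<Longrightarrow> v \<in> obj N x \<Longrightarrow> smap N x x v = v"
  using inc_module by (simp add: inc_module_def smap_def)

lemma smap_comp:
  assumes "(x, y) \<in> q" "(y, z) \<in> q" "v \<in> obj N x"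
  shows "smap N z y (smap N y x v) = smap N z x v"
proof -
  have "(1::'k) \<in> inc_hom q x y" "(1::'k) \<in> inc_hom q y z" "x \<in> Field q" "y \<in> Field q" "z \<in> Field q"
    using assms by (auto simp: inc_hom_def Field_def)
  then have "mor N x z (1 * 1) v = mor N y z 1 (mor N x y 1 v)"
    using inc_module assms(3) by (simp only: inc_module_def)
  then show ?thesis by (simp add: smap_def)
qed

lemma smap_in: "(x, y) \<in> q \<Longrightarrow> v \<in> obj N x \<Longrightarrow> smap N y x v \<in> obj N y"
  using linear_smap unfolding linear_between_def by blast

lemma smap_add: "(x, y) \<in> q \<Longrightarrow> u \<in> obj N x \<Longrightarrow> v \<in> obj N x \<Longrightarrow>
    smap N y x (u + v) = smap N y x u + smap N y x v"
  using linear_smap unfolding linear_between_def by blast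

lemma smap_scale: "(x, y) \<in> q \<Longrightarrow> v \<in> obj N x \<Longrightarrow> smap N y x (s c v) = s c (smap N y x v)"
  using linear_smap unfolding linear_between_def by blast

lemma smap_zero: "(x, y) \<in> q \<Longrightarrow> smap N y x 0 = 0"
  using linear_between_zero[OF vector_space_axioms subspace_obj linear_smap] by (auto simp: Field_def)

text \<open>Stability under all scalar multiples of a generator follows from stability under the
  generator, so only structure maps have to be checked.\<close>

lemma submodule_iff:
  "submodule q s N U \<longleftrightarrow>
     (\<forall>x\<in>Field q. U x \<subseteq> obj N x \<and> subspace (U x)) \<and>
     (\<forall>x y. (x, y) \<in> q \<longrightarrow> (\<forall>u\<in>U x. smap N y x u \<in> U y))"
proof -
  have "mor N x y c u \<in> U y"
    if "\<forall>x\<in>Field q. U x \<subseteq> obj N x \<and> subspace (U x)"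
      "\<forall>x y. (x, y) \<in> q \<longrightarrow> (\<forall>u\<in>U x. smap N y x u \<in> U y)"
      "x \<in> Field q" "y \<in> Field q" "c \<in> inc_hom q x y" "u \<in> U x" for x y c u
  proof (cases "(x, y) \<in> q")
    case True
    have "mor N x y c u = s c (smap N y x u)"
      using that by (intro mor_eq_scale_smap) auto
    then show ?thesis
      using that True subspace_scale by simp
  next
    case False
    have "mor N x y c u = s c (smap N y x u)"
      using that by (intro mor_eq_scale_smap) auto
    then show ?thesis
      using that False subspace_0 by (simp add: inc_hom_def)
  qed
  moreover have "smap N y x u \<in> U y" if "submodule q s N U" "(x, y) \<in> q" "u \<in> U x" for x y u
  proof -
    have "(1::'k) \<in> inc_hom q x y" "x \<in> Field q" "y \<in> Field q"
      using that by (auto simp: inc_hom_def Field_def)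
    then show ?thesis
      using that unfolding submodule_def smap_def by blast
  qed
  ultimately show ?thesis
    unfolding submodule_def by blast
qed

lemma obtain_spanning_set:
  assumes "x \<in> Field q"
  obtains B where "finite B" "obj N x \<subseteq> span B"
  using fin_dim_obj[OF assms] unfolding fin_dim_def by blast

lemma inc_module_submodule:
  assumes "submodule q s N U"
  shows "inc_module q s (N\<lparr>obj := U\<rparr>)"
proof -
  have U: "U x \<subseteq> obj N x" "subspace (U x)" if "x \<in> Field q" for x
    using assms that unfolding submodule_def by auto
  have mor: "mor N x y c u \<in> U y"
    if "x \<in> Field q" "y \<in> Field q" "c \<in> inc_hom q x y" "u \<in> U x" for x y c u
    using assms that unfolding submodule_def by blast
  have "fin_dim s (U x)" if x: "x \<in> Field q" for x
  proof -
    obtain B where "finite B" "obj N x \<subseteq> span B"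
      using obtain_spanning_set[OF x] .
    then show ?thesis
      using obtain_finite_basis[of B "U x"] U[OF x] unfolding fin_dim_def by (metis subset_trans)
  qed
  moreover have "linear_between s (U x) s (U y) (mor N x y c)"
    if "x \<in> Field q" "y \<in> Field q" "c \<in> inc_hom q x y" for x y c
  proof -
    show ?thesis
      using linear_mor[OF that] U[OF that(1)] mor[OF that] unfolding linear_between_def by blast
  qed
  ultimately show ?thesis
    using inc_module U mor unfolding inc_module_def by (simp add: subset_eq)
qed

lemma incidence_rep_submodule:
  "submodule q s N U \<Longrightarrow> incidence_rep q s (N\<lparr>obj := U\<rparr>)"
  using po finite_Field inc_module_submodule by unfold_locales

lemma submodule_trans:
  assumes "submodule q s N U" "submodule q s (N\<lparr>obj := U\<rparr>) W"
  shows "submodule q s N W"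
  using assms unfolding submodule_def by (simp add: subset_eq)

text \<open>Unique decomposition of vectors is separated into spanning and independence, the latter
  in the form that only the zero family sums to zero. The right-hand side also sheds the
  extensionality that \<open>PiE\<close> imposes on tuples.\<close>

lemma direct_sum_decomp_iff:
  "direct_sum_decomp q s N k U \<longleftrightarrow>
     (\<forall>i<k. submodule q s N (U i)) \<and>
     (\<forall>x\<in>Field q. \<forall>v\<in>obj N x. \<exists>u. (\<forall>i<k. u i \<in> U i x) \<and> v = (\<Sum>i<k. u i)) \<and>
     (\<forall>x\<in>Field q. \<forall>u. (\<forall>i<k. u i \<in> U i x) \<and> (\<Sum>i<k. u i) = 0 \<longrightarrow> (\<forall>i<k. u i = 0))"
    (is "_ \<longleftrightarrow> ?sub \<and> ?span \<and> ?ind")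
proof (intro iffI conjI)
  assume D: "direct_sum_decomp q s N k U"
  then show ?sub
    unfolding direct_sum_decomp_def by blast
  have ex1: "\<exists>!u. u \<in> (\<Pi>\<^sub>E i\<in>{..<k}. U i x) \<and> v = (\<Sum>i<k. u i)" if "x \<in> Field q" "v \<in> obj N x" for x v
    using D that unfolding direct_sum_decomp_def by blast
  show ?span
  proof (intro ballI)
    fix x v assume "x \<in> Field q" "v \<in> obj N x"
    then obtain u where "u \<in> (\<Pi>\<^sub>E i\<in>{..<k}. U i x)" "v = (\<Sum>i<k. u i)"
      using ex1 by blast
    then show "\<exists>u. (\<forall>i<k. u i \<in> U i x) \<and> v = (\<Sum>i<k. u i)"
      by (intro exI[of _ u]) auto
  qed
  show ?ind
  proof (intro ballI allI impI)
    fix x u i assume x: "x \<in> Field q" and u: "(\<forall>i<k. u i \<in> U i x) \<and> (\<Sum>i<k. u i) = 0" and i: "i < k"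
    have "\<forall>i<k. 0 \<in> U i x"
      using \<open>?sub\<close> x subspace_0 unfolding submodule_def by blast
    then have "(\<lambda>i\<in>{..<k}. 0) \<in> (\<Pi>\<^sub>E i\<in>{..<k}. U i x) \<and> 0 = (\<Sum>i<k. (\<lambda>i\<in>{..<k}. 0) i)"
      by auto
    moreover have "(\<lambda>i\<in>{..<k}. u i) \<in> (\<Pi>\<^sub>E i\<in>{..<k}. U i x) \<and> 0 = (\<Sum>i<k. (\<lambda>i\<in>{..<k}. u i) i)"
      using u by auto
    ultimately have "(\<lambda>i\<in>{..<k}. u i) = (\<lambda>i\<in>{..<k}. 0)"
      using ex1[OF x subspace_0[OF subspace_obj[OF x]]] by blast
    then show "u i = 0"
      using i by (metis lessThan_iff restrict_apply')
  qed
next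
  assume A: "?sub \<and> ?span \<and> ?ind"
  have "u = u'" if x: "x \<in> Field q"
    and u: "u \<in> (\<Pi>\<^sub>E i\<in>{..<k}. U i x)" "u' \<in> (\<Pi>\<^sub>E i\<in>{..<k}. U i x)" "(\<Sum>i<k. u i) = (\<Sum>i<k. u' i)"
  for x u u'
  proof (rule PiE_ext[OF u(1,2)])
    fix i assume i: "i \<in> {..<k}"
    have "\<forall>i<k. u i - u' i \<in> U i x"
      using A u x subspace_diff unfolding submodule_def by (auto simp: PiE_iff)
    moreover have "(\<Sum>i<k. u i - u' i) = 0"
      using u(3) by (simp add: sum_subtractf)
    ultimately have "u i - u' i = 0"
      using A x i by (metis (no_types, lifting) lessThan_iff)
    then show "u i = u' i" by simp
  qed
  moreover have "\<exists>u. u \<in> (\<Pi>\<^sub>E i\<in>{..<k}. U i x) \<and> v = (\<Sum>i<k. u i)"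
    if xv: "x \<in> Field q" "v \<in> obj N x" for x v
  proof -
    obtain u where "\<forall>i<k. u i \<in> U i x" "v = (\<Sum>i<k. u i)"
      using A[THEN conjunct2, THEN conjunct1, rule_format, OF xv] by (elim exE conjE)
    \<comment> \<open>\<open>restrict\<close> gives the tuple the value outside
      \<open>{..<k}\<close> that \<open>PiE\<close> prescribes.\<close>
    then show ?thesis
      by (intro exI[of _ "restrict u {..<k}"]) auto
  qed
  ultimately have "\<exists>!u. u \<in> (\<Pi>\<^sub>E i\<in>{..<k}. U i x) \<and> v = (\<Sum>i<k. u i)"
    if "x \<in> Field q" "v \<in> obj N x" for x v
    using that by (intro ex_ex1I) auto
  then show "direct_sum_decomp q s N k U"
    using A[THEN conjunct1] unfolding direct_sum_decomp_def by (intro conjI ballI)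
qed


text \<open>The \<open>i\<close>-th component of a vector. Additivity, homogeneity and compatibility
  with structure maps all come from uniqueness: in each case two families of components have the
  same sum.\<close>

lemma decomposition_projections:
  assumes "direct_sum_decomp q s N k U"
  obtains \<pi> where
    "\<And>i x. i < k \<Longrightarrow> x \<in> Field q \<Longrightarrow> linear_between s (obj N x) s (U i x) (\<pi> i x)"
    "\<And>x v. x \<in> Field q \<Longrightarrow> v \<in> obj N x \<Longrightarrow> v = (\<Sum>i<k. \<pi> i x v)"
    "\<And>i x y v. i < k \<Longrightarrow> (x, y) \<in> q \<Longrightarrow> v \<in> obj N x \<Longrightarrow> \<pi> i y (smap N y x v) = smap N y x (\<pi> i x v)"
    "\<And>i j x v. i < k \<Longrightarrow> j < k \<Longrightarrow> x \<in> Field q \<Longrightarrow> v \<in> U i x \<Longrightarrow> \<pi> j x v = (if i = j then v else 0)"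
proof -
  note D = assms[unfolded direct_sum_decomp_iff]
  have sub: "U i x \<subseteq> obj N x" "subspace (U i x)" if "i < k" "x \<in> Field q" for i x
    using D that unfolding submodule_iff by auto
  have sub_smap: "smap N y x u \<in> U i y" if "i < k" "(x, y) \<in> q" "u \<in> U i x" for i x y u
    using D that unfolding submodule_iff by auto
  have "\<forall>x v. \<exists>u. x \<in> Field q \<and> v \<in> obj N x \<longrightarrow> (\<forall>i<k. u i \<in> U i x) \<and> v = (\<Sum>i<k. u i)"
    using D[THEN conjunct2, THEN conjunct1] by blast
  then obtain p where p: "\<And>x v. x \<in> Field q \<Longrightarrow> v \<in> obj N x \<Longrightarrow>
      (\<forall>i<k. p x v i \<in> U i x) \<and> v = (\<Sum>i<k. p x v i)"
    by metis
  have uniq: "p x v i = u i"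
    if "x \<in> Field q" "v \<in> obj N x" "\<And>i. i < k \<Longrightarrow> u i \<in> U i x" "v = (\<Sum>i<k. u i)" "i < k" for x v u i
  proof -
    have "\<forall>i<k. p x v i - u i \<in> U i x"
      using p[OF that(1,2)] that(3) subspace_diff sub(2)[OF _ that(1)] by blast
    moreover have "(\<Sum>i<k. p x v i - u i) = 0"
      using p[OF that(1,2)] that(4) by (simp add: sum_subtractf)
    ultimately have "p x v i - u i = 0"
      using D[THEN conjunct2, THEN conjunct2, rule_format, OF that(1), of "\<lambda>i. p x v i - u i" i] that(5)
      by blast
    then show ?thesis by simp
  qed
  show thesis
  proof (rule that[of "\<lambda>i x v. p x v i"])
    fix i x assume i: "i < k" and x: "x \<in> Field q"
    have "p x (u + v) i = p x u i + p x v i" if uv: "u \<in> obj N x" "v \<in> obj N x" for u v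
    proof (rule uniq[OF x _ _ _ i])
      show "u + v \<in> obj N x"
        using subspace_add[OF subspace_obj[OF x]] uv .
      show "p x u i + p x v i \<in> U i x" if "i < k" for i
        using subspace_add[OF sub(2)[OF that x]] p[OF x uv(1)] p[OF x uv(2)] that by blast
      show "u + v = (\<Sum>i<k. p x u i + p x v i)"
        using p[OF x uv(1)] p[OF x uv(2)] by (simp add: sum.distrib)
    qed
    moreover have "p x (s c v) i = s c (p x v i)" if v: "v \<in> obj N x" for c v
    proof (rule uniq[OF x _ _ _ i])
      show "s c v \<in> obj N x"
        using subspace_scale[OF subspace_obj[OF x]] v .
      show "s c (p x v i) \<in> U i x" if "i < k" for i
        using subspace_scale[OF sub(2)[OF that x]] p[OF x v] that by blast
      show "s c v = (\<Sum>i<k. s c (p x v i))"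
        using p[OF x v] by (metis scale_sum_right)
    qed
    ultimately show "linear_between s (obj N x) s (U i x) (\<lambda>v. p x v i)"
      using p[OF x] i by (simp add: linear_between_def)
  next
    show "v = (\<Sum>i<k. p x v i)" if "x \<in> Field q" "v \<in> obj N x" for x v
      using p[OF that] by blast
  next
    fix i x y v assume i: "i < k" and xy: "(x, y) \<in> q" and v: "v \<in> obj N x"
    have F: "x \<in> Field q" "y \<in> Field q"
      using xy by (auto simp: Field_def)
    show "p y (smap N y x v) i = smap N y x (p x v i)"
    proof (rule uniq[OF F(2) smap_in[OF xy v] _ _ i])
      show "smap N y x (p x v i) \<in> U i y" if "i < k" for i
        using sub_smap[OF that xy] p[OF F(1) v] that by blast
      have "smap N y x (\<Sum>i<k. p x v i) = (\<Sum>i<k. smap N y x (p x v i))"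
        using p[OF F(1) v] sub(1)[OF _ F(1)]
        by (intro linear_between_sum[OF vector_space_axioms subspace_obj[OF F(1)] linear_smap[OF xy]]) blast
      then show "smap N y x v = (\<Sum>i<k. smap N y x (p x v i))"
        using p[OF F(1) v] by metis
    qed
  next
    fix i j x v assume ij: "i < k" "j < k" and x: "x \<in> Field q" and v: "v \<in> U i x"
    have "p x v j = (\<lambda>j. if i = j then v else 0) j"
      using sub[OF ij(1) x] v subspace_0[OF sub(2)[OF _ x]] ij
      by (intro uniq[OF x]) auto
    then show "p x v j = (if i = j then v else 0)" by simp
  qed
qed

text \<open>The gluing step for the existence of decompositions: the two halves are refined
  separately, and the indices of the second refinement are shifted by \<open>k\<close>.\<close>

lemma direct_sum_decomp_append:
  assumes "direct_sum_decomp q s N 2 U"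
    and "direct_sum_decomp q s (N\<lparr>obj := U 0\<rparr>) k V" "direct_sum_decomp q s (N\<lparr>obj := U 1\<rparr>) l W"
  shows "direct_sum_decomp q s N (k + l) (\<lambda>i. if i < k then V i else W (i - k))"
    (is "direct_sum_decomp q s N _ ?Z")
proof -
  note D = assms(1)[unfolded direct_sum_decomp_iff]
  have U: "submodule q s N (U 0)" "submodule q s N (U 1)"
    using D by (auto simp: numeral_2_eq_2)
  interpret U0: incidence_rep q s "N\<lparr>obj := U 0\<rparr>" by (rule incidence_rep_submodule[OF U(1)])
  interpret U1: incidence_rep q s "N\<lparr>obj := U 1\<rparr>" by (rule incidence_rep_submodule[OF U(2)])
  note V = assms(2)[unfolded U0.direct_sum_decomp_iff]
  note W = assms(3)[unfolded U1.direct_sum_decomp_iff]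
  have split_sum: "(\<Sum>i<k + l. f i) = (\<Sum>i<k. f i) + (\<Sum>i<l. f (k + i))" for f :: "nat \<Rightarrow> 'v"
    by (induction l) (simp_all add: add.assoc)
  show ?thesis
    unfolding direct_sum_decomp_iff
  proof (intro conjI ballI allI impI)
    fix i assume i: "i < k + l"
    show "submodule q s N (?Z i)"
    proof (cases "i < k")
      case True
      then show ?thesis
        using submodule_trans[OF U(1)] V by simp
    next
      case False
      then have "i - k < l" using i by simp
      then show ?thesis
        using submodule_trans[OF U(2)] W False by simp
    qed
  next
    fix x v assume x: "x \<in> Field q" and v: "v \<in> obj N x"
    obtain u where u: "\<forall>i<2. u i \<in> U i x" "v = (\<Sum>i<2. u i)"
      using D x v by blast
    then have u2: "u 0 \<in> U 0 x" "u 1 \<in> U 1 x" "v = u 0 + u 1"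
      by (simp_all add: numeral_2_eq_2)
    obtain f where f: "\<forall>i<k. f i \<in> V i x" "u 0 = (\<Sum>i<k. f i)"
      using V[THEN conjunct2, THEN conjunct1, rule_format, OF x, of "u 0"] u2(1) by auto
    obtain g where g: "\<forall>i<l. g i \<in> W i x" "u 1 = (\<Sum>i<l. g i)"
      using W[THEN conjunct2, THEN conjunct1, rule_format, OF x, of "u 1"] u2(2) by auto
    show "\<exists>u. (\<forall>i<k + l. u i \<in> ?Z i x) \<and> v = (\<Sum>i<k + l. u i)"
    proof (intro exI conjI)
      let ?h = "\<lambda>i. if i < k then f i else g (i - k)"
      show "\<forall>i<k + l. ?h i \<in> ?Z i x"
        using f(1) g(1) by auto
      show "v = (\<Sum>i<k + l. ?h i)"
        unfolding u2(3) f(2) g(2) split_sum by simp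
    qed
  next
    fix x u i assume x: "x \<in> Field q" and u: "(\<forall>i<k + l. u i \<in> ?Z i x) \<and> (\<Sum>i<k + l. u i) = 0" and i: "i < k + l"
    \<comment> \<open>The coarse decomposition sees only these two partial sums, one in
      \<open>U 0\<close> and one in \<open>U 1\<close>. Both vanish by its independence, after which
      each refinement can be used by itself.\<close>
    let ?f = "\<Sum>i<k. u i" and ?g = "\<Sum>i<l. u (k + i)"
    have ui: "u i \<in> V i x" if "i < k" for i
      using u[THEN conjunct1, rule_format, of i] that by simp
    have ui': "u (k + i) \<in> W i x" if "i < l" for i
      using u[THEN conjunct1, rule_format, of "k + i"] that by simp
    have VU: "V i x \<subseteq> U 0 x" if "i < k" for i
      using V x that unfolding U0.submodule_iff by auto
    have WU: "W i x \<subseteq> U 1 x" if "i < l" for i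
      using W x that unfolding U1.submodule_iff by auto
    have f: "?f \<in> U 0 x"
      using U(1) x ui VU unfolding submodule_iff by (intro subspace_sum) auto
    have g: "?g \<in> U 1 x"
      using U(2) x ui' WU unfolding submodule_iff by (intro subspace_sum) auto
    have "(\<forall>i<2. (\<lambda>i::nat. if i = 0 then ?f else ?g) i \<in> U i x) \<and>
        (\<Sum>i<2. (\<lambda>i::nat. if i = 0 then ?f else ?g) i) = 0"
      using f g u by (auto simp: split_sum numeral_2_eq_2 less_Suc_eq)
    then have "\<forall>i<2::nat. (if i = 0 then ?f else ?g) = 0"
      using D[THEN conjunct2, THEN conjunct2, rule_format, OF x, of "\<lambda>i. if i = 0 then ?f else ?g"] by blast
    from this[rule_format, of 0] this[rule_format, of 1] have fg0: "?f = 0" "?g = 0"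
      by simp_all
    show "u i = 0"
    proof (cases "i < k")
      case True
      then show ?thesis
        using V[THEN conjunct2, THEN conjunct2, rule_format, OF x, of u] ui fg0(1) by blast
    next
      case False
      then have "i - k < l" "u i = u (k + (i - k))" using i by auto
      then show ?thesis
        using W[THEN conjunct2, THEN conjunct2, rule_format, OF x, of "\<lambda>i. u (k + i)"] ui' fg0(2) by metis
    qed
  qed
qed

text \<open>Were \<open>U i x\<close> everything, then \<open>u\<close> in \<open>U j x\<close> and
  \<open>- u\<close> in \<open>U i x\<close> would sum to zero, forcing
  \<open>u = 0\<close>.\<close>

lemma summand_neq_obj:
  assumes "direct_sum_decomp q s N 2 U" "i < 2" "j < 2" "i \<noteq> j" "x \<in> Field q" "U j x \<noteq> {0}"
  shows "U i x \<noteq> obj N x"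
proof
  assume eq: "U i x = obj N x"
  note D = assms(1)[unfolded direct_sum_decomp_iff]
  have U: "U j x \<subseteq> obj N x" "subspace (U j x)"
    using D assms(3,5) by (simp_all add: submodule_iff)
  have "u = 0" if u: "u \<in> U j x" for u
  proof -
    let ?f = "\<lambda>l. if l = j then u else - u"
    have "- u \<in> obj N x"
      using U u subspace_neg subspace_obj[OF assms(5)] by blast
    moreover have "l = i \<or> l = j" if "l < 2" for l
      using that assms(2-4) by linarith
    ultimately have "\<forall>l<2::nat. ?f l \<in> U l x"
      using eq u by auto
    moreover have "(\<Sum>l<2. ?f l) = 0"
      using assms(3) by (auto simp: numeral_2_eq_2 less_Suc_eq)
    ultimately have "?f j = 0"
      using D[THEN conjunct2, THEN conjunct2, rule_format, OF assms(5), of ?f j] assms(3) by blast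
    then show ?thesis by simp
  qed
  then show False
    using assms(6) subspace_0[OF U(2)] by blast
qed

text \<open>The dimension of the summand cannot increase at any vertex, and it drops at a vertex
  where the complementary summand is nonzero.\<close>

lemma summand_total_dim_less:
  assumes "direct_sum_decomp q s N 2 U" "i < 2" "j < 2" "i \<noteq> j" "\<not> inc_zero q (N\<lparr>obj := U j\<rparr>)"
  shows "(\<Sum>x\<in>Field q. dim (U i x)) < (\<Sum>x\<in>Field q. dim (obj N x))"
proof (rule sum_strict_mono_ex1[OF finite_Field])
  have U: "U i x \<subseteq> obj N x" "subspace (U i x)" if "x \<in> Field q" for x
    using assms(1,2) that by (simp_all add: direct_sum_decomp_iff submodule_iff)
  show "\<forall>x\<in>Field q. dim (U i x) \<le> dim (obj N x)"
  proof
    fix x assume x: "x \<in> Field q"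
    obtain B where "finite B" "obj N x \<subseteq> span B"
      using obtain_spanning_set[OF x] .
    then show "dim (U i x) \<le> dim (obj N x)"
      using subspace_dim_mono[OF _ _ subspace_obj[OF x] U(2,1)[OF x]] by blast
  qed
  obtain x where x: "x \<in> Field q" "U j x \<noteq> {0}"
    using assms(5) by (auto simp: inc_zero_def)
  obtain B where "finite B" "obj N x \<subseteq> span B"
    using obtain_spanning_set[OF x(1)] .
  then have "dim (U i x) < dim (obj N x)"
    using subspace_dim_less[OF _ _ subspace_obj[OF x(1)] U(2,1)[OF x(1)]]
      summand_neq_obj[OF assms(1-4) x] by blast
  then show "\<exists>x\<in>Field q. dim (U i x) < dim (obj N x)"
    using x(1) by blast
qed

end

text \<open>Induction on the total dimension over all vertices, splitting as long as a proper
  splitting exists. It is stated outside the locale because the representation varies in the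
  induction.\<close>

lemma indec_decomp_exists:
  assumes "incidence_rep q s N"
  shows "\<exists>k U. indec_decomp q s N k U"
  using assms
proof (induction "\<Sum>x\<in>Field q. vector_space.dim s (obj N x)" arbitrary: N rule: less_induct)
  case less
  interpret incidence_rep q s N by (rule less.prems)
  have self: "submodule q s N (obj N)"
    using subspace_obj smap_in by (simp add: submodule_iff)
  show ?case
  proof (cases "inc_zero q N")
    case True
    \<comment> \<open>The zero module is not indecomposable; it is the empty direct sum.\<close>
    have "indec_decomp q s N 0 U" for U
      using True by (simp add: indec_decomp_def direct_sum_decomp_iff inc_zero_def)
    then show ?thesis by blast
  next
    case nonzero: False
    show ?thesis
    proof (cases "indecomposable q s N")
      case True
      have "indec_decomp q s N 1 (\<lambda>_. obj N)"
        using True self by (auto simp: indec_decomp_def direct_sum_decomp_iff)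
      then show ?thesis by blast
    next
      case False
      then obtain U where U: "direct_sum_decomp q s N 2 U"
        "\<not> inc_zero q (N\<lparr>obj := U 0\<rparr>)" "\<not> inc_zero q (N\<lparr>obj := U 1\<rparr>)"
        using nonzero unfolding indecomposable_def by blast
      have sub: "submodule q s N (U 0)" "submodule q s N (U 1)"
        using U(1) by (simp_all add: direct_sum_decomp_iff)
      obtain k V where V: "indec_decomp q s (N\<lparr>obj := U 0\<rparr>) k V"
        using less.hyps[of "N\<lparr>obj := U 0\<rparr>"] incidence_rep_submodule[OF sub(1)]
          summand_total_dim_less[OF U(1) _ _ _ U(3), of 0] by auto
      obtain l W where W: "indec_decomp q s (N\<lparr>obj := U 1\<rparr>) l W"
        using less.hyps[of "N\<lparr>obj := U 1\<rparr>"] incidence_rep_submodule[OF sub(2)]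
          summand_total_dim_less[OF U(1) _ _ _ U(2), of 1] by auto
      have "indec_decomp q s N (k + l) (\<lambda>i. if i < k then V i else W (i - k))"
        using V W direct_sum_decomp_append[OF U(1)] by (auto simp: indec_decomp_def)
      then show ?thesis by blast
    qed
  qed
qed

section \<open>Limits, dual colimits, and the matrices that present them\<close>

context incidence_rep
begin

text \<open>The limit. The family of subspaces is a parameter, so that the same notion serves
  \<open>N\<close> and its submodules; values outside \<open>Field q\<close> are
  unconstrained.\<close>

definition sections :: "('x \<Rightarrow> 'v set) \<Rightarrow> ('x \<Rightarrow> 'v) set" where
  "sections U = {\<sigma>. (\<forall>x\<in>Field q. \<sigma> x \<in> U x) \<and> (\<forall>x y. (x, y) \<in> q \<longrightarrow> smap N y x (\<sigma> x) = \<sigma> y)}"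

text \<open>Compatible families of functionals, that is, the dual space of the colimit;
  equivalently, the morphisms to the constant module.\<close>

definition cocones :: "('x \<Rightarrow> 'v set) \<Rightarrow> ('x \<Rightarrow> 'v \<Rightarrow> 'k) set" where
  "cocones U = {p. (\<forall>x\<in>Field q. linear_between s (U x) (*) UNIV (p x)) \<and>
     (\<forall>x y. (x, y) \<in> q \<longrightarrow> (\<forall>u\<in>U x. p y (smap N y x u) = p x u))}"

lemma FieldD: "(x, y) \<in> q \<Longrightarrow> x \<in> Field q" "(x, y) \<in> q \<Longrightarrow> y \<in> Field q"
  by (auto simp: Field_def)

lemma sc_below: "x \<in> Field q \<Longrightarrow> \<exists>c\<in>sc q. (c, x) \<in> q"
  using minimal_below[OF po finite_Field] by blast

lemma sk_above: "x \<in> Field q \<Longrightarrow> \<exists>b\<in>sk q. (x, b) \<in> q"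
  using maximal_above[OF po finite_Field] by blast

lemma sc_subset: "sc q \<subseteq> Field q" and sk_subset: "sk q \<subseteq> Field q"
  by (auto simp: minimals_def maximals_def)

lemma sc1D:
  assumes "(A, c) \<in> sc1 q"
  shows "A \<subseteq> sc q" "card A = 2" "c \<in> Field q" "x \<in> A \<Longrightarrow> (x, c) \<in> q"
proof -
  show A: "A \<subseteq> sc q" "card A = 2"
    using assms by (auto simp: sc1_def)
  show x: "(x, c) \<in> q" if "x \<in> A" for x
    using assms that by (auto simp: sc1_def minimals_def above_def)
  obtain x where "x \<in> A"
    using A(2) by (auto simp: card_2_iff)
  then show "c \<in> Field q"
    using x FieldD by blast
qed

lemma sk1D:
  assumes "(B, d) \<in> sk1 q"
  shows "B \<subseteq> sk q" "card B = 2" "d \<in> Field q" "x \<in> B \<Longrightarrow> (d, x) \<in> q"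
proof -
  show B: "B \<subseteq> sk q" "card B = 2"
    using assms by (auto simp: sk1_def)
  show x: "(d, x) \<in> q" if "x \<in> B" for x
    using assms that by (auto simp: sk1_def maximals_def under_def)
  obtain x where "x \<in> B"
    using B(2) by (auto simp: card_2_iff)
  then show "d \<in> Field q"
    using x FieldD by blast
qed

lemma finite_sc: "finite (sc q)" and finite_sk: "finite (sk q)"
  using finite_subset[OF sc_subset finite_Field] finite_subset[OF sk_subset finite_Field] by auto

lemma finite_sc1: "finite (sc1 q)"
proof (rule finite_subset)
  show "sc1 q \<subseteq> Pow (sc q) \<times> Field q"
    using sc1D by auto
qed (use finite_sc finite_Field in auto)

lemma finite_sk1: "finite (sk1 q)"
proof (rule finite_subset)
  show "sk1 q \<subseteq> Pow (sk q) \<times> Field q"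
    using sk1D by auto
qed (use finite_sk finite_Field in auto)

text \<open>Any agreement of two sources that is wanted at a common upper bound \<open>x\<close> can
  be checked at a minimal common upper bound below \<open>x\<close>, hence in a row of
  \<open>M_tilde\<close>.\<close>

lemma sc1_exists:
  assumes "a \<in> sc q" "a' \<in> sc q" "a \<noteq> a'" "(a, x) \<in> q" "(a', x) \<in> q"
  shows "\<exists>c. ({a, a'}, c) \<in> sc1 q \<and> (c, x) \<in> q"
proof -
  let ?S = "\<Inter>y\<in>{a, a'}. above q y"
  have "?S \<subseteq> Field q" "x \<in> ?S"
    using assms(4,5) FieldD by (auto simp: above_def)
  then obtain c where "c \<in> minimals q ?S" "(c, x) \<in> q"
    using minimal_below[OF po finite_subset[OF _ finite_Field]] by blast
  then show ?thesis
    using assms(1-3) by (auto simp: sc1_def)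
qed

lemma sk1_exists:
  assumes "b \<in> sk q" "b' \<in> sk q" "b \<noteq> b'" "(x, b) \<in> q" "(x, b') \<in> q"
  shows "\<exists>d. ({b, b'}, d) \<in> sk1 q \<and> (x, d) \<in> q"
proof -
  let ?S = "\<Inter>y\<in>{b, b'}. under q y"
  have "?S \<subseteq> Field q" "x \<in> ?S"
    using assms(4,5) FieldD by (auto simp: under_def)
  then obtain d where "d \<in> maximals q ?S" "(x, d) \<in> q"
    using maximal_above[OF po finite_subset[OF _ finite_Field]] by blast
  then show ?thesis
    using assms(1-3) by (auto simp: sk1_def)
qed

text \<open>As \<open>A\<close> consists of its lower and its upper element, the membership test in
  \<open>M_tilde\<close> is subsumed by the two equality tests.\<close>

lemma M_tilde_entry:
  assumes "bij_betw a {1..n} (sc q)" "(A, c) \<in> sc1 q"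
  shows "M_tilde (\<lambda>x. x) a n N (A, c) x v =
    (if x = lower a n A then smap N c x v else if x = upper a n A then - smap N c x v else 0)"
proof -
  have "A = {lower a n A, upper a n A}"
    using lower_upper(1)[OF assms(1) sc1D(1,2)[OF assms(2)]] .
  then show ?thesis
    unfolding M_tilde_def by auto
qed

lemma M_hat_entry:
  assumes "bij_betw b {1..m} (sk q)" "(B, d) \<in> sk1 q"
  shows "M_hat (\<lambda>x. x) b m N y (B, d) v =
    (if y = lower b m B then smap N y d v else if y = upper b m B then - smap N y d v else 0)"
proof -
  have "B = {lower b m B, upper b m B}"
    using lower_upper(1)[OF assms(1) sk1D(1,2)[OF assms(2)]] .
  then show ?thesis
    unfolding M_hat_def by auto
qed

lemma linear_between_uminus_smap:
  assumes "(x, y) \<in> q"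
  shows "linear_between s (obj N x) s (obj N y) (\<lambda>v. - smap N y x v)"
  using linear_smap[OF assms] subspace_neg[OF subspace_obj[OF FieldD(2)[OF assms]]]
  by (simp add: linear_between_def scale_minus_right)

lemma linear_between_zero_map:
  assumes "x \<in> Field q"
  shows "linear_between s V s (obj N x) (\<lambda>_. 0)"
  using subspace_0[OF subspace_obj[OF assms]] by (simp add: linear_between_def)

lemma linear_M_tilde:
  assumes "bij_betw a {1..n} (sc q)" "r \<in> sc1 q" "x \<in> sc q"
  shows "linear_between s (obj N x) s (obj N (snd r)) (M_tilde (\<lambda>x. x) a n N r x)"
proof -
  obtain A c where r: "r = (A, c)" by force
  note Ac = assms(2)[unfolded r]
  have "A = {lower a n A, upper a n A}"
    using lower_upper(1)[OF assms(1) sc1D(1,2)[OF Ac]] .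
  then have le: "(lower a n A, c) \<in> q" "(upper a n A, c) \<in> q"
    using sc1D(4)[OF Ac] by blast+
  show ?thesis
    unfolding r M_tilde_entry[OF assms(1) Ac, abs_def]
    by (cases "x = lower a n A"; cases "x = upper a n A")
      (use linear_smap linear_between_uminus_smap linear_between_zero_map[OF sc1D(3)[OF Ac]] le in simp_all)
qed

lemma linear_M_hat:
  assumes "bij_betw b {1..m} (sk q)" "c \<in> sk1 q" "y \<in> sk q"
  shows "linear_between s (obj N (snd c)) s (obj N y) (M_hat (\<lambda>x. x) b m N y c)"
proof -
  obtain B d where c: "c = (B, d)" by force
  note Bd = assms(2)[unfolded c]
  have "B = {lower b m B, upper b m B}"
    using lower_upper(1)[OF assms(1) sk1D(1,2)[OF Bd]] .
  then have le: "(d, lower b m B) \<in> q" "(d, upper b m B) \<in> q"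
    using sk1D(4)[OF Bd] by blast+
  have y: "y \<in> Field q"
    using assms(3) sk_subset by blast
  show ?thesis
    unfolding c M_hat_entry[OF assms(1) Bd, abs_def]
    by (cases "y = lower b m B"; cases "y = upper b m B")
      (use linear_smap linear_between_uminus_smap linear_between_zero_map[OF y] le in simp_all)
qed

lemma M_tilde_row:
  assumes "bij_betw a {1..n} (sc q)" "(A, c) \<in> sc1 q"
  shows "matrix_map (sc1 q) (sc q) (M_tilde (\<lambda>x. x) a n N) v (A, c) =
    smap N c (lower a n A) (v (lower a n A)) - smap N c (upper a n A) (v (upper a n A))"
proof -
  have A: "A = {lower a n A, upper a n A}" "lower a n A \<noteq> upper a n A"
    using lower_upper[OF assms(1) sc1D(1,2)[OF assms(2)]] by auto
  have "matrix_map (sc1 q) (sc q) (M_tilde (\<lambda>x. x) a n N) v (A, c) =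
      (\<Sum>x\<in>sc q. M_tilde (\<lambda>x. x) a n N (A, c) x (v x))"
    using assms(2) by (simp add: matrix_map_def)
  also have "\<dots> = (\<Sum>x\<in>{lower a n A, upper a n A}. M_tilde (\<lambda>x. x) a n N (A, c) x (v x))"
    using sc1D(1)[OF assms(2)] A(1) M_tilde_entry[OF assms]
    by (intro sum.mono_neutral_right finite_sc) auto
  also have "\<dots> = smap N c (lower a n A) (v (lower a n A)) - smap N c (upper a n A) (v (upper a n A))"
    using A(2) by (simp add: M_tilde_entry[OF assms])
  finally show ?thesis .
qed

text \<open>The kernel of the map \<open>M_tilde\<close> is the limit of \<open>N\<close>, restricted to the minimal elements.\<close>

lemma M_tilde_kernel_iff:
  assumes a: "bij_betw a {1..n} (sc q)" and v: "v \<in> family_sum (sc q) (obj N)"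
  shows "matrix_map (sc1 q) (sc q) (M_tilde (\<lambda>x. x) a n N) v = 0 \<longleftrightarrow>
    (\<exists>\<sigma>\<in>sections (obj N). \<forall>x\<in>sc q. v x = \<sigma> x)" (is "?v = 0 \<longleftrightarrow> _")
proof
  assume 0: "?v = 0"
  \<comment> \<open>The row of a minimal common upper bound \<open>c\<close> of \<open>y\<close> and
    \<open>y'\<close> with \<open>c\<close> below \<open>x\<close> gives agreement at
    \<open>c\<close>, which is then carried on to \<open>x\<close>.\<close>
  have indep: "smap N x y (v y) = smap N x y' (v y')"
    if y: "y \<in> sc q" "y' \<in> sc q" "(y, x) \<in> q" "(y', x) \<in> q" for x y y'
  proof (cases "y = y'")
    case False
    then obtain c where c: "({y, y'}, c) \<in> sc1 q" "(c, x) \<in> q"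
      using sc1_exists[OF y(1,2) False y(3,4)] by blast
    have in': "v y \<in> obj N y" "v y' \<in> obj N y'"
      using v y by (auto simp: family_sum_def)
    have q': "(y, c) \<in> q" "(y', c) \<in> q"
      using sc1D(4)[OF c(1)] by auto
    let ?A = "{y, y'}"
    have "smap N c (lower a n ?A) (v (lower a n ?A)) = smap N c (upper a n ?A) (v (upper a n ?A))"
      using M_tilde_row[OF a c(1), of v] 0 by simp
    then have "smap N c y (v y) = smap N c y' (v y')"
      using lower_upper(1)[OF a sc1D(1,2)[OF c(1)]] by (auto simp: doubleton_eq_iff)
    then show ?thesis
      using smap_comp[OF q'(1) c(2) in'(1)] smap_comp[OF q'(2) c(2) in'(2)] by metis
  qed simp
  \<comment> \<open>The section is transported to each vertex from some minimal element below it; by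
    \<open>indep\<close> the choice does not affect the value.\<close>
  obtain \<alpha> where \<alpha>: "\<And>x. x \<in> Field q \<Longrightarrow> \<alpha> x \<in> sc q \<and> (\<alpha> x, x) \<in> q"
    using sc_below by metis
  define \<sigma> where "\<sigma> x = smap N x (\<alpha> x) (v (\<alpha> x))" for x
  have v\<alpha>: "v (\<alpha> x) \<in> obj N (\<alpha> x)" if "x \<in> Field q" for x
    using v \<alpha>[OF that] by (simp add: family_sum_def)
  have "\<sigma> \<in> sections (obj N)"
    unfolding sections_def
  proof (intro CollectI conjI ballI allI impI)
    show "\<sigma> x \<in> obj N x" if "x \<in> Field q" for x
      unfolding \<sigma>_def using smap_in \<alpha> v\<alpha> that by blast
    fix x y assume xy: "(x, y) \<in> q"
    then have x: "x \<in> Field q" and y: "y \<in> Field q" using FieldD by blast+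
    have "smap N y x (\<sigma> x) = smap N y (\<alpha> x) (v (\<alpha> x))"
      unfolding \<sigma>_def using smap_comp[OF _ xy v\<alpha>[OF x]] \<alpha>[OF x] by blast
    also have "\<dots> = \<sigma> y"
      unfolding \<sigma>_def using \<alpha>[OF x] \<alpha>[OF y] Partial_order_trans[OF po _ xy] by (intro indep) auto
    finally show "smap N y x (\<sigma> x) = \<sigma> y" .
  qed
  moreover have "v x = \<sigma> x" if x: "x \<in> sc q" for x
  proof -
    have F: "x \<in> Field q" using x sc_subset by blast
    have "v x = smap N x x (v x)"
      using smap_id[OF F] v x by (simp add: family_sum_def)
    also have "\<dots> = \<sigma> x"
      unfolding \<sigma>_def using \<alpha>[OF F] x Partial_order_refl[OF po F] by (intro indep) auto
    finally show ?thesis .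
  qed
  ultimately show "\<exists>\<sigma>\<in>sections (obj N). \<forall>x\<in>sc q. v x = \<sigma> x" by blast
next
  assume "\<exists>\<sigma>\<in>sections (obj N). \<forall>x\<in>sc q. v x = \<sigma> x"
  then obtain \<sigma> where \<sigma>: "\<sigma> \<in> sections (obj N)" "\<forall>x\<in>sc q. v x = \<sigma> x" by blast
  have "?v r = 0" for r
  proof (cases "r \<in> sc1 q")
    case True
    obtain A c where r: "r = (A, c)" by force
    note Ac = True[unfolded r]
    have A: "A = {lower a n A, upper a n A}"
      using lower_upper(1)[OF a sc1D(1,2)[OF Ac]] .
    then have "(lower a n A, c) \<in> q" "(upper a n A, c) \<in> q" "lower a n A \<in> sc q" "upper a n A \<in> sc q"
      using sc1D(1,4)[OF Ac] by blast+
    then show ?thesis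
      unfolding r M_tilde_row[OF a Ac] using \<sigma> by (simp add: sections_def)
  qed (simp add: matrix_map_def)
  then show "?v = 0"
    by (simp add: fun_eq_iff)
qed

text \<open>The space of relations: the colimit is the sum over the maximal elements modulo this
  subspace.\<close>

abbreviation hat_image :: "(nat \<Rightarrow> 'x) \<Rightarrow> nat \<Rightarrow> ('x \<Rightarrow> 'v) set" where
  "hat_image b m \<equiv> matrix_map (sk q) (sk1 q) (M_hat (\<lambda>x. x) b m N) ` family_sum (sk1 q) (\<lambda>c. obj N (snd c))"

lemma hat_image_subspace:
  assumes "bij_betw b {1..m} (sk q)"
  shows "module.subspace (pointwise_scale s) (hat_image b m)"
    and "hat_image b m \<subseteq> family_sum (sk q) (obj N)"
proof -
  have lin: "linear_between (pointwise_scale s) (family_sum (sk1 q) (\<lambda>c. obj N (snd c)))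
    (pointwise_scale s) (family_sum (sk q) (obj N)) (matrix_map (sk q) (sk1 q) (M_hat (\<lambda>x. x) b m N))"
    using linear_M_hat[OF assms] subspace_obj sk_subset
    by (intro matrix_map_linear_between vector_space_axioms) auto
  then show "hat_image b m \<subseteq> family_sum (sk q) (obj N)"
    by (auto simp: linear_between_def)
  have "module.subspace (pointwise_scale s) (family_sum (sk1 q) (\<lambda>c. obj N (snd c)))"
    using subspace_obj sk1D(3) by (intro subspace_family_sum vector_space_axioms) auto
  then show "module.subspace (pointwise_scale s) (hat_image b m)"
    by (intro linear_between_image_subspace[OF _ _ _ lin] vector_space_pointwise_scale vector_space_axioms)
qed

text \<open>This is the column of \<open>M_hat\<close> at \<open>(B, d)\<close> applied to
  \<open>w\<close>: the relation that identifies the images of \<open>w\<close> at two maximal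
  elements.\<close>

lemma hat_image_difference:
  assumes b: "bij_betw b {1..m} (sk q)" and Bd: "(B, d) \<in> sk1 q" and w: "w \<in> obj N d"
  shows "single_at (lower b m B) (smap N (lower b m B) d w) -
    single_at (upper b m B) (smap N (upper b m B) d w) \<in> hat_image b m" (is "?z \<in> _")
proof -
  let ?w = "single_at (B, d) w"
  have B: "B = {lower b m B, upper b m B}" "lower b m B \<noteq> upper b m B"
    using lower_upper[OF b sk1D(1,2)[OF Bd]] by auto
  have sub: "0 \<in> obj N (snd c)" "subspace (obj N (snd c))" if "c \<in> sk1 q" for c
    using that sk1D(3)[of "fst c" "snd c"] subspace_obj subspace_0 by auto
  have "?w \<in> family_sum (sk1 q) (\<lambda>c. obj N (snd c))"
    using sub(1) Bd w by (intro single_at_in_family_sum) auto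
  moreover have "matrix_map (sk q) (sk1 q) (M_hat (\<lambda>x. x) b m N) ?w y = ?z y" for y
  proof (cases "y \<in> sk q")
    case True
    have "M_hat (\<lambda>x. x) b m N y c 0 = 0" if "c \<in> sk1 q" for c
      using linear_between_zero[OF vector_space_axioms sub(2)[OF that] linear_M_hat[OF b that True]] .
    then have "(\<Sum>c\<in>sk1 q. M_hat (\<lambda>x. x) b m N y c (?w c)) = (\<Sum>c\<in>{(B, d)}. M_hat (\<lambda>x. x) b m N y c (?w c))"
      using Bd by (intro sum.mono_neutral_right finite_sk1) (auto simp: single_at_def)
    then show ?thesis
      using True B(2) by (simp add: matrix_map_def M_hat_entry[OF b Bd] single_at_def)
  next
    case False
    then have "y \<noteq> lower b m B" "y \<noteq> upper b m B"
      using B(1) sk1D(1)[OF Bd] by blast+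
    then show ?thesis
      using False by (simp add: matrix_map_def single_at_def)
  qed
  then have "matrix_map (sk q) (sk1 q) (M_hat (\<lambda>x. x) b m N) ?w = ?z"
    by (rule ext)
  ultimately show ?thesis
    by (metis image_eqI)
qed

text \<open>On each column the cocone takes equal values at the two images of the same vector, and
  these carry opposite signs.\<close>

lemma cocone_vanishes_on_hat_image:
  assumes b: "bij_betw b {1..m} (sk q)" and p: "p \<in> cocones (obj N)" and h: "h \<in> hat_image b m"
  shows "(\<Sum>y\<in>sk q. p y (h y)) = 0"
proof -
  obtain w where w: "w \<in> family_sum (sk1 q) (\<lambda>c. obj N (snd c))"
    and h: "h = matrix_map (sk q) (sk1 q) (M_hat (\<lambda>x. x) b m N) w"
    using h by blast
  have wc: "w c \<in> obj N (snd c)" if "c \<in> sk1 q" for c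
    using w that by (simp add: family_sum_def)
  have lin: "linear_between s (obj N y) (*) UNIV (p y)" if "y \<in> Field q" for y
    using p that by (simp add: cocones_def)
  have "p y (h y) = (\<Sum>c\<in>sk1 q. p y (M_hat (\<lambda>x. x) b m N y c (w c)))" if y: "y \<in> sk q" for y
  proof -
    have F: "y \<in> Field q" using y sk_subset by blast
    have "M_hat (\<lambda>x. x) b m N y c (w c) \<in> obj N y" if "c \<in> sk1 q" for c
      using linear_M_hat[OF b that y] wc[OF that] by (simp add: linear_between_def)
    then show ?thesis
      using y by (simp add: h matrix_map_def linear_between_sum[OF vector_space_axioms subspace_obj[OF F] lin[OF F]])
  qed
  then have "(\<Sum>y\<in>sk q. p y (h y)) = (\<Sum>y\<in>sk q. \<Sum>c\<in>sk1 q. p y (M_hat (\<lambda>x. x) b m N y c (w c)))"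
    by simp
  also have "\<dots> = (\<Sum>c\<in>sk1 q. \<Sum>y\<in>sk q. p y (M_hat (\<lambda>x. x) b m N y c (w c)))"
    by (rule sum.swap)
  also have "\<dots> = 0"
  proof (rule sum.neutral, rule ballI)
    fix c assume c: "c \<in> sk1 q"
    obtain B d where Bd': "c = (B, d)" by force
    note Bd = c[unfolded Bd']
    have B: "B = {lower b m B, upper b m B}" "lower b m B \<noteq> upper b m B"
      using lower_upper[OF b sk1D(1,2)[OF Bd]] by auto
    have sub: "{lower b m B, upper b m B} \<subseteq> sk q"
      using B(1) sk1D(1)[OF Bd] by blast
    have le: "(d, lower b m B) \<in> q" "(d, upper b m B) \<in> q"
      using B(1) sk1D(4)[OF Bd] by blast+
    have wd: "w (B, d) \<in> obj N d"
      using wc[OF Bd] by simp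
    have p0: "p y 0 = 0" if "y \<in> sk q" for y
      using linear_between_zero[OF vector_space_axioms subspace_obj lin] that sk_subset by blast
    have pneg: "p y (- v) = - p y v" if "y \<in> Field q" "v \<in> obj N y" for y v
    proof -
      have "p y (s (- 1) v) = - 1 * p y v"
        using lin[OF that(1)] that(2) unfolding linear_between_def by blast
      then show ?thesis by simp
    qed
    have "(\<Sum>y\<in>sk q. p y (M_hat (\<lambda>x. x) b m N y c (w c))) =
        (\<Sum>y\<in>{lower b m B, upper b m B}. p y (M_hat (\<lambda>x. x) b m N y c (w c)))"
      using sub p0 M_hat_entry[OF b Bd] Bd' by (intro sum.mono_neutral_right finite_sk) auto
    also have "\<dots> = p (lower b m B) (smap N (lower b m B) d (w (B, d))) -
        p (upper b m B) (smap N (upper b m B) d (w (B, d)))"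
      using B(2) pneg[OF FieldD(2)[OF le(2)] smap_in[OF le(2) wd]]
      by (simp add: Bd' M_hat_entry[OF b Bd])
    also have "\<dots> = p d (w (B, d)) - p d (w (B, d))"
      using p le wd by (simp add: cocones_def)
    finally show "(\<Sum>y\<in>sk q. p y (M_hat (\<lambda>x. x) b m N y c (w c))) = 0" by simp
  qed
  finally show ?thesis .
qed

text \<open>Functionals vanishing on the image of \<open>M_hat\<close> are functionals on the colimit of \<open>N\<close>.\<close>

lemma cocone_detecting:
  assumes b: "bij_betw b {1..m} (sk q)" and y: "y \<in> sk q" and v: "v \<in> obj N y"
    and notin: "single_at y v \<notin> hat_image b m"
  shows "\<exists>p\<in>cocones (obj N). p y v = 1"
proof -
  \<comment> \<open>A functional on the colimit, so far known only on the sum over the maximal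
    elements.\<close>
  obtain g where g: "Vector_Spaces.linear (pointwise_scale s) (*) g" "g (single_at y v) = 1"
    "\<And>h. h \<in> hat_image b m \<Longrightarrow> g h = 0"
    using exists_functional[OF vector_space_pointwise_scale[OF vector_space_axioms]
        hat_image_subspace(1)[OF b] notin] by blast
  interpret g: Vector_Spaces.linear "pointwise_scale s" "(*)" g by (rule g(1))
  interpret sa: Vector_Spaces.linear s "pointwise_scale s" "single_at z" for z :: 'x
    by (rule linear_single_at[OF vector_space_axioms])
  \<comment> \<open>Two maximal elements above \<open>x\<close> have a maximal common lower bound
    \<open>d\<close> above \<open>x\<close>; the relation at \<open>d\<close>, applied to the image
    of \<open>u\<close> there, is killed by \<open>g\<close>.\<close>
  have indep: "g (single_at z (smap N z x u)) = g (single_at z' (smap N z' x u))"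
    if z: "z \<in> sk q" "z' \<in> sk q" "(x, z) \<in> q" "(x, z') \<in> q" and u: "u \<in> obj N x" for x z z' u
  proof (cases "z = z'")
    case False
    then obtain d where d: "({z, z'}, d) \<in> sk1 q" "(x, d) \<in> q"
      using sk1_exists[OF z(1,2) False z(3,4)] by blast
    have q': "(d, z) \<in> q" "(d, z') \<in> q"
      using sk1D(4)[OF d(1)] by auto
    let ?B = "{z, z'}" and ?u = "smap N d x u"
    have "g (single_at (lower b m ?B) (smap N (lower b m ?B) d ?u)) =
        g (single_at (upper b m ?B) (smap N (upper b m ?B) d ?u))"
      using g(3)[OF hat_image_difference[OF b d(1) smap_in[OF d(2) u]]] by (simp add: g.diff)
    then have "g (single_at z (smap N z d ?u)) = g (single_at z' (smap N z' d ?u))"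
      using lower_upper(1)[OF b sk1D(1,2)[OF d(1)]] by (auto simp: doubleton_eq_iff)
    then show ?thesis
      using smap_comp[OF d(2) q'(1) u] smap_comp[OF d(2) q'(2) u] by simp
  qed simp
  obtain \<beta> where \<beta>: "\<And>x. x \<in> Field q \<Longrightarrow> \<beta> x \<in> sk q \<and> (x, \<beta> x) \<in> q"
    using sk_above by metis
  \<comment> \<open>At an arbitrary vertex the functional is defined by transport to some maximal
    element above; \<open>indep\<close> makes the choice immaterial and yields
    compatibility.\<close>
  define p where "p x u = g (single_at (\<beta> x) (smap N (\<beta> x) x u))" for x u
  have "p \<in> cocones (obj N)"
    unfolding cocones_def
  proof (intro CollectI conjI ballI allI impI)
    show "linear_between s (obj N x) (*) UNIV (p x)" if "x \<in> Field q" for x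
      using \<beta>[OF that]
      by (simp add: linear_between_def p_def smap_add smap_scale sa.add sa.scale g.add g.scale)
    fix x z u assume xz: "(x, z) \<in> q" and u: "u \<in> obj N x"
    then have x: "x \<in> Field q" and z: "z \<in> Field q" using FieldD by blast+
    have "p z (smap N z x u) = g (single_at (\<beta> z) (smap N (\<beta> z) x u))"
      unfolding p_def using smap_comp[OF xz _ u] \<beta>[OF z] by simp
    also have "\<dots> = p x u"
      unfolding p_def using \<beta>[OF x] \<beta>[OF z] Partial_order_trans[OF po xz] u by (intro indep) auto
    finally show "p z (smap N z x u) = p x u" .
  qed
  moreover have "p y v = 1"
  proof -
    have F: "y \<in> Field q" using y sk_subset by blast
    have "p y v = g (single_at y (smap N y y v))"
      unfolding p_def using \<beta>[OF F] y v Partial_order_refl[OF po F] by (intro indep) auto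
    then show ?thesis
      using g(2) smap_id[OF F v] by simp
  qed
  ultimately show ?thesis by blast
qed

end

section \<open>The multiplicity of the constant module\<close>

text \<open>Prescribes values only on morphisms that exist, so the pulled-back interval module
  satisfies it without passing to an isomorphic copy.\<close>

definition constant_module :: "'x rel \<Rightarrow> ('x, 'k::field, 'k) inc_functor \<Rightarrow> bool" where
  "constant_module q X \<longleftrightarrow>
     (\<forall>x\<in>Field q. obj X x = UNIV) \<and>
     (\<forall>x\<in>Field q. \<forall>y\<in>Field q. \<forall>c\<in>inc_hom q x y. \<forall>v. mor X x y c v = c * v)"

context incidence_rep
begin

lemma smap_obj_update [simp]: "smap (N\<lparr>obj := U\<rparr>) = smap N"
  by (simp add: smap_def fun_eq_iff)

text \<open>The splitting is explicit: the line through the section and the kernel of the cocone are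
  complementary submodules. The line is nonzero, so indecomposability makes the kernel vanish, and
  \<open>p\<close> itself is the isomorphism.\<close>

lemma iso_constant_of_retraction:
  assumes conn: "poset_connected q (Field q)" and X: "constant_module q X"
    and \<sigma>: "\<sigma> \<in> sections (obj N)" and p: "p \<in> cocones (obj N)"
    and y: "y \<in> Field q" and one: "p y (\<sigma> y) = 1"
    and indec: "indecomposable q s N"
  shows "inc_iso q s N (*) X"
proof -
  have \<sigma>_in: "\<sigma> x \<in> obj N x" if "x \<in> Field q" for x
    using \<sigma> that by (simp add: sections_def)
  have \<sigma>_smap: "smap N z x (\<sigma> x) = \<sigma> z" if "(x, z) \<in> q" for x z
    using \<sigma> that by (simp add: sections_def)
  have p_lin: "linear_between s (obj N x) (*) UNIV (p x)" if "x \<in> Field q" for x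
    using p that by (simp add: cocones_def)
  have p_add: "p x (u + v) = p x u + p x v" if "x \<in> Field q" "u \<in> obj N x" "v \<in> obj N x" for x u v
    using p_lin[OF that(1)] that by (simp add: linear_between_def)
  have p_scale: "p x (s c u) = c * p x u" if "x \<in> Field q" "u \<in> obj N x" for x c u
    using p_lin[OF that(1)] that by (simp add: linear_between_def)
  have p_zero: "p x 0 = 0" if "x \<in> Field q" for x
    using linear_between_zero[OF vector_space_axioms subspace_obj[OF that] p_lin[OF that]] .
  have p_smap: "p z (smap N z x u) = p x u" if "(x, z) \<in> q" "u \<in> obj N x" for x z u
    using p that by (simp add: cocones_def)
  \<comment> \<open>This scalar is unchanged along every relation, so connectedness spreads the
    value 1 from \<open>y\<close> to all vertices.\<close>
  have "p x (\<sigma> x) = p z (\<sigma> z)" if xz: "(x, z) \<in> q" for x z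
    using p_smap[OF xz \<sigma>_in[OF FieldD(1)[OF xz]]] \<sigma>_smap[OF xz] by simp
  then have p_one: "p x (\<sigma> x) = 1" if x: "x \<in> Field q" for x
    using poset_connected_constant[OF conn, of "\<lambda>x. p x (\<sigma> x)", OF _ x y] one by simp
  let ?U = "\<lambda>(i :: nat) x. if i = 0 then span {\<sigma> x} else {u \<in> obj N x. p x u = 0}"
  have span_in: "span {\<sigma> x} \<subseteq> obj N x" if "x \<in> Field q" for x
    using \<sigma>_in[OF that] subspace_obj[OF that] by (intro span_minimal) auto
  have "submodule q s N (?U 0)"
    unfolding submodule_iff
  proof (intro conjI ballI allI impI)
    fix x z u assume xz: "(x, z) \<in> q" and "u \<in> ?U 0 x"
    then obtain c where "u = s c (\<sigma> x)"
      by (auto simp: span_singleton)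
    then show "smap N z x u \<in> ?U 0 z"
      using smap_scale[OF xz \<sigma>_in[OF FieldD(1)[OF xz]]] \<sigma>_smap[OF xz] by (auto simp: span_singleton)
  qed (use span_in in auto)
  moreover have "submodule q s N (?U 1)"
    unfolding submodule_iff
  proof (intro conjI ballI allI impI)
    fix x assume x: "x \<in> Field q"
    show "?U 1 x \<subseteq> obj N x" by auto
    show "subspace (?U 1 x)"
      using subspace_0[OF subspace_obj[OF x]] subspace_add[OF subspace_obj[OF x]]
        subspace_scale[OF subspace_obj[OF x]] p_zero[OF x] p_add[OF x] p_scale[OF x]
      by (intro subspaceI) auto
  qed (use smap_in p_smap in auto)
  ultimately have "\<forall>i<2. submodule q s N (?U i)"
    by (simp add: numeral_2_eq_2 less_Suc_eq)
  moreover have "\<exists>u. (\<forall>i<2. u i \<in> ?U i x) \<and> v = (\<Sum>i<2. u i)" if x: "x \<in> Field q" and v: "v \<in> obj N x" for x v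
  proof (intro exI conjI)
    \<comment> \<open>Since \<open>p x (\<sigma> x)\<close> is 1, subtracting this multiple of the
      section leaves a vector in the kernel of \<open>p x\<close>.\<close>
    let ?a = "s (p x v) (\<sigma> x)"
    let ?u = "\<lambda>i::nat. if i = 0 then ?a else v - ?a"
    have a: "?a \<in> span {\<sigma> x}"
      by (auto simp: span_singleton)
    have va: "v - ?a \<in> obj N x"
      using a span_in[OF x] subspace_diff[OF subspace_obj[OF x] v] by blast
    have "p x v = p x ((v - ?a) + ?a)" by simp
    also have "\<dots> = p x (v - ?a) + p x ?a"
      using p_add[OF x va] a span_in[OF x] by blast
    also have "p x ?a = p x v"
      using p_scale[OF x \<sigma>_in[OF x]] p_one[OF x] by simp
    finally show "\<forall>i<2. ?u i \<in> ?U i x"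
      using a va by simp
    show "v = (\<Sum>i<2. ?u i)"
      by (simp add: numeral_2_eq_2)
  qed
  moreover have "u i = 0"
    if x: "x \<in> Field q" and u: "(\<forall>i<2. u i \<in> ?U i x) \<and> (\<Sum>i<2. u i) = 0" and i: "i < 2" for x u i
  proof -
    have u0: "u 0 \<in> span {\<sigma> x}" "u 1 \<in> obj N x" "p x (u 1) = 0" "u 0 + u 1 = 0"
      using u[THEN conjunct1, rule_format, of 0] u[THEN conjunct1, rule_format, of 1] u
      by (simp_all add: numeral_2_eq_2)
    then obtain c where c: "u 0 = s c (\<sigma> x)"
      by (auto simp: span_singleton)
    have "0 = p x (u 0 + u 1)"
      using u0(4) p_zero[OF x] by simp
    also have "\<dots> = c"
      using p_add[OF x subsetD[OF span_in[OF x] u0(1)] u0(2)] u0(3) p_scale[OF x \<sigma>_in[OF x]] p_one[OF x]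
      by (simp add: c)
    finally have "u 0 = 0"
      by (simp add: c)
    moreover have "i = 0 \<or> i = 1"
      using i by auto
    ultimately show ?thesis
      using u0(4) by auto
  qed
  ultimately have "direct_sum_decomp q s N 2 ?U"
    unfolding direct_sum_decomp_iff by blast
  then have "inc_zero q (N\<lparr>obj := ?U 0\<rparr>) \<or> inc_zero q (N\<lparr>obj := ?U 1\<rparr>)"
    using indec unfolding indecomposable_def by blast
  moreover have "\<not> inc_zero q (N\<lparr>obj := ?U 0\<rparr>)"
  proof
    assume "inc_zero q (N\<lparr>obj := ?U 0\<rparr>)"
    then have "span {\<sigma> y} = {0}"
      using y by (simp add: inc_zero_def)
    then have "\<sigma> y = 0"
      using span_base[of "\<sigma> y" "{\<sigma> y}"] by simp
    then show False
      using one p_zero[OF y] by simp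
  qed
  ultimately have "inc_zero q (N\<lparr>obj := ?U 1\<rparr>)"
    by blast
  then have "\<forall>x\<in>Field q. {u \<in> obj N x. p x u = 0} = {0}"
    by (simp add: inc_zero_def)
  then have ker: "u = 0" if "x \<in> Field q" "u \<in> obj N x" "p x u = 0" for x u
    using that by blast
  have "bij_betw (p x) (obj N x) UNIV" if x: "x \<in> Field q" for x
    unfolding bij_betw_def
  proof
    show "inj_on (p x) (obj N x)"
    proof (rule inj_onI)
      fix u v assume uv: "u \<in> obj N x" "v \<in> obj N x" "p x u = p x v"
      have d: "u - v \<in> obj N x"
        using subspace_diff[OF subspace_obj[OF x] uv(1,2)] .
      have "p x u = p x (u - v) + p x v"
        using p_add[OF x d uv(2)] by simp
      then show "u = v"
        using ker[OF x d] uv(3) by simp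
    qed
    have "c = p x (s c (\<sigma> x))" "s c (\<sigma> x) \<in> obj N x" for c
      using p_scale[OF x \<sigma>_in[OF x]] p_one[OF x] subspace_scale[OF subspace_obj[OF x] \<sigma>_in[OF x]] by simp_all
    then show "p x ` obj N x = UNIV"
      by blast
  qed
  moreover have "p z (mor N x z c v) = mor X x z c (p x v)"
    if xz: "x \<in> Field q" "z \<in> Field q" and c: "c \<in> inc_hom q x z" and v: "v \<in> obj N x" for x z c v
  proof (cases "(x, z) \<in> q")
    case True
    then show ?thesis
      using X xz c mor_eq_scale_smap[OF xz c v] p_scale[OF xz(2) smap_in[OF True v]] p_smap[OF True v]
      by (simp add: constant_module_def)
  next
    case False
    then show ?thesis
      using X xz c mor_eq_scale_smap[OF xz c v] p_zero[OF xz(2)]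
      by (simp add: constant_module_def inc_hom_def)
  qed
  ultimately show ?thesis
    using X p_lin unfolding inc_iso_def constant_module_def by (intro exI[of _ p]) simp
qed

text \<open>The isomorphism is the cocone, and the preimages of 1 form the section. Injectivity is
  recorded because it makes every other section a multiple of this one at each vertex.\<close>

lemma section_cocone_of_iso_constant:
  assumes X: "constant_module q X" and iso: "inc_iso q s N (*) X"
  shows "\<exists>\<sigma>\<in>sections (obj N). \<exists>p\<in>cocones (obj N).
    (\<forall>x\<in>Field q. p x (\<sigma> x) = 1) \<and> (\<forall>x\<in>Field q. inj_on (p x) (obj N x))"
proof -
  obtain p where p: "\<And>x. x \<in> Field q \<Longrightarrow> linear_between s (obj N x) (*) UNIV (p x)"
    "\<And>x. x \<in> Field q \<Longrightarrow> bij_betw (p x) (obj N x) UNIV"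
    "\<And>x z c v. x \<in> Field q \<Longrightarrow> z \<in> Field q \<Longrightarrow> c \<in> inc_hom q x z \<Longrightarrow> v \<in> obj N x \<Longrightarrow>
      p z (mor N x z c v) = mor X x z c (p x v)"
    using iso X unfolding inc_iso_def constant_module_def by (elim exE conjE) (simp, blast)
  have p_smap: "p z (smap N z x u) = p x u" if xz: "(x, z) \<in> q" and u: "u \<in> obj N x" for x z u
  proof -
    have "(1::'k) \<in> inc_hom q x z"
      using xz by (simp add: inc_hom_def)
    then show ?thesis
      using p(3)[of x z 1 u] X xz u FieldD[OF xz] by (simp add: smap_def constant_module_def)
  qed
  have "\<forall>x. \<exists>v. x \<in> Field q \<longrightarrow> v \<in> obj N x \<and> p x v = 1"
    using p(2) unfolding bij_betw_def by (metis UNIV_I imageE)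
  then obtain \<sigma> where \<sigma>: "\<And>x. x \<in> Field q \<Longrightarrow> \<sigma> x \<in> obj N x \<and> p x (\<sigma> x) = 1"
    by metis
  have inj: "inj_on (p x) (obj N x)" if "x \<in> Field q" for x
    using p(2)[OF that] by (simp add: bij_betw_def)
  have "smap N z x (\<sigma> x) = \<sigma> z" if xz: "(x, z) \<in> q" for x z
  proof (rule inj_onD[OF inj])
    show "p z (smap N z x (\<sigma> x)) = p z (\<sigma> z)"
      using p_smap[OF xz] \<sigma> FieldD[OF xz] by simp
  qed (use \<sigma> FieldD[OF xz] smap_in[OF xz] in auto)
  then have "\<sigma> \<in> sections (obj N)"
    using \<sigma> by (simp add: sections_def)
  moreover have "p \<in> cocones (obj N)"
    using p(1) p_smap by (simp add: cocones_def)
  ultimately show ?thesis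
    using \<sigma> inj by blast
qed

text \<open>Both notions depend on the representation only through its structure maps, which a
  submodule inherits.\<close>

lemma sections_submodule: "incidence_rep.sections q (N\<lparr>obj := U\<rparr>) = sections"
  and cocones_submodule: "incidence_rep.cocones q s (N\<lparr>obj := U\<rparr>) = cocones"
  if "submodule q s N U"
proof -
  interpret U: incidence_rep q s "N\<lparr>obj := U\<rparr>"
    by (rule incidence_rep_submodule[OF that])
  show "U.sections = sections" "U.cocones = cocones"
    unfolding U.sections_def[abs_def] sections_def[abs_def] U.cocones_def[abs_def] cocones_def[abs_def]
    by simp_all
qed

text \<open>The left-hand side is the dimension of the image of the limit together with the
  relations, and it does not involve \<open>U\<close>. Each constant summand contributes one vector,
  dual cocones show that these vectors are independent modulo the relations, and the remaining
  summands contribute nothing new.\<close>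

lemma dim_canonical_map_image:
  assumes conn: "poset_connected q (Field q)" and X: "constant_module q X"
    and b: "bij_betw b {1..m} (sk q)" and b1: "b1 \<in> sk q"
    and dec: "indec_decomp q s N k U"
  shows "vector_space.dim (pointwise_scale s) {single_at b1 (\<sigma> b1) + h |\<sigma> h. \<sigma> \<in> sections (obj N) \<and> h \<in> hat_image b m}
    = vector_space.dim (pointwise_scale s) (hat_image b m)
      + card {i. i < k \<and> inc_iso q s (N\<lparr>obj := U i\<rparr>) (*) X}"
    (is "vector_space.dim _ ?D = vector_space.dim _ ?H + card ?J")
proof -
  interpret ps: vector_space "pointwise_scale s :: 'k \<Rightarrow> ('x \<Rightarrow> 'v) \<Rightarrow> 'x \<Rightarrow> 'v"
    by (rule vector_space_pointwise_scale[OF vector_space_axioms])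
  interpret sa: Vector_Spaces.linear s "pointwise_scale s" "single_at b1"
    by (rule linear_single_at[OF vector_space_axioms])
  have D: "direct_sum_decomp q s N k U"
    and indec: "\<And>i. i < k \<Longrightarrow> indecomposable q s (N\<lparr>obj := U i\<rparr>)"
    using dec by (auto simp: indec_decomp_def)
  have sub: "submodule q s N (U i)" if "i < k" for i
    using D that by (simp add: direct_sum_decomp_iff)
  have U: "U i x \<subseteq> obj N x" "subspace (U i x)" if "i < k" "x \<in> Field q" for i x
    using sub[OF that(1)] that(2) by (simp_all add: submodule_iff)
  have b1F: "b1 \<in> Field q"
    using b1 sk_subset by blast
  obtain \<pi> where \<pi>_lin: "\<And>i x. i < k \<Longrightarrow> x \<in> Field q \<Longrightarrow> linear_between s (obj N x) s (U i x) (\<pi> i x)"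
    and \<pi>_sum: "\<And>x v. x \<in> Field q \<Longrightarrow> v \<in> obj N x \<Longrightarrow> v = (\<Sum>i<k. \<pi> i x v)"
    and \<pi>_smap: "\<And>i x y v. i < k \<Longrightarrow> (x, y) \<in> q \<Longrightarrow> v \<in> obj N x \<Longrightarrow> \<pi> i y (smap N y x v) = smap N y x (\<pi> i x v)"
    and \<pi>_id: "\<And>i j x v. i < k \<Longrightarrow> j < k \<Longrightarrow> x \<in> Field q \<Longrightarrow> v \<in> U i x \<Longrightarrow> \<pi> j x v = (if i = j then v else 0)"
  proof (rule decomposition_projections[OF D], goal_cases)
    case (1 \<pi>)
    show ?thesis by (rule that) (fact 1)+
  qed
  have \<pi>_in: "\<pi> i x v \<in> U i x" if "i < k" "x \<in> Field q" "v \<in> obj N x" for i x v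
    using \<pi>_lin[OF that(1,2)] that(3) by (simp add: linear_between_def)
  have "\<forall>i\<in>?J. \<exists>\<tau> r. \<tau> \<in> sections (U i) \<and> r \<in> cocones (U i) \<and>
    (\<forall>x\<in>Field q. r x (\<tau> x) = 1) \<and> (\<forall>x\<in>Field q. inj_on (r x) (U i x))"
  proof
    fix i assume "i \<in> ?J"
    then have i: "i < k" "inc_iso q s (N\<lparr>obj := U i\<rparr>) (*) X" by auto
    interpret Ui: incidence_rep q s "N\<lparr>obj := U i\<rparr>"
      by (rule incidence_rep_submodule[OF sub[OF i(1)]])
    show "\<exists>\<tau> r. \<tau> \<in> sections (U i) \<and> r \<in> cocones (U i) \<and>
      (\<forall>x\<in>Field q. r x (\<tau> x) = 1) \<and> (\<forall>x\<in>Field q. inj_on (r x) (U i x))"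
      using Ui.section_cocone_of_iso_constant[OF X i(2)]
      unfolding sections_submodule[OF sub[OF i(1)]] cocones_submodule[OF sub[OF i(1)]] by auto
  qed
  then obtain \<tau> r where \<tau>: "\<And>i. i \<in> ?J \<Longrightarrow> \<tau> i \<in> sections (U i)" and r: "\<And>i. i \<in> ?J \<Longrightarrow> r i \<in> cocones (U i)"
    and r\<tau>: "\<And>i x. i \<in> ?J \<Longrightarrow> x \<in> Field q \<Longrightarrow> r i x (\<tau> i x) = 1"
    and r_inj: "\<And>i x. i \<in> ?J \<Longrightarrow> x \<in> Field q \<Longrightarrow> inj_on (r i x) (U i x)"
    unfolding Ball_def choice_iff' by blast
  have \<tau>_in: "\<tau> i x \<in> U i x" if "i \<in> ?J" "x \<in> Field q" for i x
    using \<tau>[OF that(1)] that(2) by (simp add: sections_def)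
  have sections_mono: "sections (U i) \<subseteq> sections (obj N)" if "i < k" for i
    using U(1)[OF that] by (auto simp: sections_def)
  have cocones_mono: "cocones (obj N) \<subseteq> cocones (U i)" if "i < k" for i
  proof
    fix p assume p: "p \<in> cocones (obj N)"
    have "linear_between s (U i x) (*) UNIV (p x)" if x: "x \<in> Field q" for x
      using p U(1)[OF \<open>i < k\<close> x] x by (auto simp: cocones_def linear_between_def subset_eq)
    moreover have "p y (smap N y x u) = p x u" if xy: "(x, y) \<in> q" and u: "u \<in> U i x" for x y u
      using p U(1)[OF \<open>i < k\<close> FieldD(1)[OF xy]] xy u by (auto simp: cocones_def)
    ultimately show "p \<in> cocones (U i)"
      by (simp add: cocones_def)
  qed
  \<comment> \<open>The projections commute with structure maps, so a section splits into sections
    of the summands.\<close>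
  have component: "(\<lambda>x. \<pi> i x (\<sigma> x)) \<in> sections (U i)" if i: "i < k" and \<sigma>: "\<sigma> \<in> sections (obj N)" for i \<sigma>
    using \<sigma> \<pi>_in[OF i] \<pi>_smap[OF i, symmetric] FieldD by (simp add: sections_def)
  \<comment> \<open>If the value survived in the colimit, some cocone of \<open>N\<close> would take
    the value 1 on it; restricted to \<open>U i\<close>, that cocone would make the summand
    constant.\<close>
  have other: "single_at b1 (\<sigma> b1) \<in> ?H" if i: "i < k" "i \<notin> ?J" and \<sigma>: "\<sigma> \<in> sections (U i)" for i \<sigma>
  proof (rule ccontr)
    assume notin: "single_at b1 (\<sigma> b1) \<notin> ?H"
    have "\<sigma> b1 \<in> obj N b1"
      using sections_mono[OF i(1)] \<sigma> b1F by (auto simp: sections_def)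
    then obtain p where p: "p \<in> cocones (obj N)" "p b1 (\<sigma> b1) = 1"
      using cocone_detecting[OF b b1 _ notin] by blast
    interpret Ui: incidence_rep q s "N\<lparr>obj := U i\<rparr>"
      by (rule incidence_rep_submodule[OF sub[OF i(1)]])
    have "inc_iso q s (N\<lparr>obj := U i\<rparr>) (*) X"
    proof (rule Ui.iso_constant_of_retraction[where \<sigma> = \<sigma> and p = p, OF conn X _ _ b1F p(2) indec[OF i(1)]])
      show "\<sigma> \<in> Ui.sections (obj (N\<lparr>obj := U i\<rparr>))"
        using \<sigma> by (simp add: sections_submodule[OF sub[OF i(1)]])
      show "p \<in> Ui.cocones (obj (N\<lparr>obj := U i\<rparr>))"
        using cocones_mono[OF i(1)] p(1) by (auto simp: cocones_submodule[OF sub[OF i(1)]])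
    qed
    then show False using i by simp
  qed
  \<comment> \<open>The coefficient is forced: \<open>r i b1\<close> is injective and takes the
    value 1 at \<open>\<tau> i b1\<close>.\<close>
  have iso: "\<exists>c. \<sigma> b1 = s c (\<tau> i b1)" if i: "i \<in> ?J" and \<sigma>: "\<sigma> \<in> sections (U i)" for i \<sigma>
  proof (intro exI inj_onD[OF r_inj[OF i b1F]])
    have ik: "i < k" using i by simp
    show "r i b1 (\<sigma> b1) = r i b1 (s (r i b1 (\<sigma> b1)) (\<tau> i b1))"
      using r[OF i] r\<tau>[OF i b1F] \<tau>_in[OF i b1F] b1F by (simp add: cocones_def linear_between_def)
    show "\<sigma> b1 \<in> U i b1"
      using \<sigma> b1F by (simp add: sections_def)
    show "s (r i b1 (\<sigma> b1)) (\<tau> i b1) \<in> U i b1"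
      using subspace_scale[OF U(2)[OF ik b1F]] \<tau>_in[OF i b1F] .
  qed
  let ?w = "\<lambda>i. single_at b1 (\<tau> i b1)"
  have H: "ps.subspace ?H" "?H \<subseteq> family_sum (sk q) (obj N)"
    using hat_image_subspace[OF b] by auto
  have N0: "0 \<in> obj N x" if "x \<in> Field q" for x
    using subspace_0[OF subspace_obj[OF that]] .
  have Dsub: "ps.subspace ?D"
  proof -
    have "(\<lambda>_. 0) \<in> sections (obj N)"
      using N0 smap_zero by (simp add: sections_def)
    moreover have "(\<lambda>x. \<sigma> x + \<rho> x) \<in> sections (obj N)" if "\<sigma> \<in> sections (obj N)" "\<rho> \<in> sections (obj N)" for \<sigma> \<rho>
      using that subspace_add[OF subspace_obj] smap_add FieldD by (simp add: sections_def)
    moreover have "(\<lambda>x. s c (\<sigma> x)) \<in> sections (obj N)" if "\<sigma> \<in> sections (obj N)" for c \<sigma>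
      using that subspace_scale[OF subspace_obj] smap_scale FieldD by (simp add: sections_def)
    ultimately have "subspace ((\<lambda>\<sigma>. \<sigma> b1) ` sections (obj N))"
      by (intro subspaceI) (force simp: image_iff)+
    then have "ps.subspace (single_at b1 ` (\<lambda>\<sigma>. \<sigma> b1) ` sections (obj N))"
      by (rule sa.subspace_image)
    from ps.subspace_sums[OF this H(1)] show ?thesis
      by (rule back_subst[of ps.subspace]) blast
  qed
  have "?D = ps.span (?H \<union> ?w ` ?J)"
  proof
    show "?D \<subseteq> ps.span (?H \<union> ?w ` ?J)"
    proof
      fix z assume "z \<in> ?D"
      then obtain \<sigma> h where \<sigma>: "\<sigma> \<in> sections (obj N)" and h: "h \<in> ?H" and z: "z = single_at b1 (\<sigma> b1) + h"
        by blast
      \<comment> \<open>Components in constant summands are multiples of the vectors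
        \<open>?w i\<close>; all others already lie in \<open>?H\<close>.\<close>
      have "single_at b1 (\<pi> i b1 (\<sigma> b1)) \<in> ps.span (?H \<union> ?w ` ?J)" if i: "i < k" for i
      proof (cases "i \<in> ?J")
        case True
        obtain c where "\<pi> i b1 (\<sigma> b1) = s c (\<tau> i b1)"
          using iso[OF True component[OF i \<sigma>]] by blast
        then show ?thesis
          using True by (simp only: sa.scale) (intro ps.span_scale ps.span_base, blast)
      next
        case False
        then show ?thesis
          using other[OF i False component[OF i \<sigma>]] by (intro ps.span_base) blast
      qed
      then have "single_at b1 (\<Sum>i<k. \<pi> i b1 (\<sigma> b1)) \<in> ps.span (?H \<union> ?w ` ?J)"
        unfolding sa.sum by (intro ps.span_sum) simp
      moreover have "\<sigma> b1 = (\<Sum>i<k. \<pi> i b1 (\<sigma> b1))"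
        using \<sigma> b1F by (intro \<pi>_sum) (auto simp: sections_def)
      ultimately have "single_at b1 (\<sigma> b1) \<in> ps.span (?H \<union> ?w ` ?J)"
        by (rule ssubst[of _ _ "\<lambda>v. single_at b1 v \<in> _", rotated])
      moreover have "h \<in> ps.span (?H \<union> ?w ` ?J)"
        using h by (intro ps.span_base) blast
      ultimately show "z \<in> ps.span (?H \<union> ?w ` ?J)"
        unfolding z by (rule ps.span_add)
    qed
    have zero_section: "(\<lambda>_. 0) \<in> sections (obj N)"
      using N0 smap_zero by (simp add: sections_def)
    have "?H \<subseteq> ?D"
    proof
      fix h assume "h \<in> ?H"
      then show "h \<in> ?D"
        using zero_section by (intro CollectI exI[of _ "\<lambda>_. 0"] exI[of _ h]) simp
    qed
    moreover have "?w i \<in> ?D" if i: "i \<in> ?J" for i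
    proof -
      have "\<tau> i \<in> sections (obj N)"
        using \<tau>[OF i] sections_mono i by blast
      then show ?thesis
        using ps.subspace_0[OF H(1)] by (intro CollectI exI[of _ "\<tau> i"] exI[of _ 0]) simp
    qed
    ultimately show "ps.span (?H \<union> ?w ` ?J) \<subseteq> ?D"
      by (intro ps.span_minimal[OF _ Dsub]) blast
  qed
  moreover
  let ?F = "family_sum (sk q) (obj N)"
  \<comment> \<open>The cocone of a summand becomes a cocone of \<open>N\<close> by precomposition
    with the projection; \<open>?G i\<close> is the functional it induces on the sum over the
    maximal elements.\<close>
  let ?p = "\<lambda>i x v. r i x (\<pi> i x v)"
  let ?G = "\<lambda>i f. \<Sum>x\<in>sk q. ?p i x (f x)"
  have p: "?p i \<in> cocones (obj N)" if i: "i \<in> ?J" for i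
  proof -
    have ik: "i < k" using i by simp
    have "linear_between s (obj N x) (*) UNIV (?p i x)" if x: "x \<in> Field q" for x
      using \<pi>_lin[OF ik x] r[OF i] x by (simp add: cocones_def linear_between_def)
    moreover have "?p i y (smap N y x u) = ?p i x u" if xy: "(x, y) \<in> q" and u: "u \<in> obj N x" for x y u
      using \<pi>_smap[OF ik xy u] r[OF i] xy \<pi>_in[OF ik FieldD(1)[OF xy] u] by (simp add: cocones_def)
    ultimately show ?thesis by (simp add: cocones_def)
  qed
  have p_lin: "linear_between s (obj N x) (*) UNIV (?p i x)" if "i \<in> ?J" "x \<in> Field q" for i x
    using p[OF that(1)] that(2) by (simp add: cocones_def)
  have Fsub: "ps.subspace ?F"
    using subspace_obj sk_subset by (intro subspace_family_sum vector_space_axioms) auto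
  obtain B where "finite B" "?F \<subseteq> ps.span B"
    using family_sum_finitely_spanned[OF vector_space_axioms finite_sk, of "obj N"] fin_dim_obj sk_subset by blast
  then have "ps.dim (ps.span (?H \<union> ?w ` ?J)) = ps.dim ?H + card ?J"
  proof (intro ps.dim_span_dual[where F = ?F and G = ?G])
    show "?H \<subseteq> ps.span B"
      using H(2) \<open>?F \<subseteq> ps.span B\<close> by blast
    fix i assume i: "i \<in> ?J"
    then have ik: "i < k" by simp
    note lin = p_lin[OF i, OF subsetD[OF sk_subset]]
    have G_add: "?G i (f + g) = ?G i f + ?G i g" if "f \<in> ?F" "g \<in> ?F" for f g
      using that lin by (simp add: family_sum_def linear_between_def flip: sum.distrib)
    have G_scale: "?G i (pointwise_scale s c f) = c * ?G i f" if "f \<in> ?F" for c f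
      using that lin by (simp add: family_sum_def linear_between_def pointwise_scale_def sum_distrib_left)
    have p0: "?p i x 0 = 0" if "x \<in> sk q" for x
      using linear_between_zero[OF vector_space_axioms subspace_obj lin] that sk_subset by blast
    have G_zero: "?G i 0 = 0"
      using p0 by simp
    show "ps.subspace {f \<in> ?F. ?G i f = 0}"
      using ps.subspace_0[OF Fsub] ps.subspace_add[OF Fsub] ps.subspace_scale[OF Fsub] G_add G_scale G_zero
      by (intro ps.subspaceI) auto
    show "?w i \<in> ?F"
      using N0 sk_subset b1 U(1)[OF ik b1F] \<tau>_in[OF i b1F] by (intro single_at_in_family_sum) auto
    show "?G i h = 0" if "h \<in> ?H" for h
      using cocone_vanishes_on_hat_image[OF b p[OF i] that] .
    \<comment> \<open>Only the entry of \<open>?w j\<close> at \<open>b1\<close> counts, and the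
      projection to \<open>U i\<close> kills it unless \<open>j = i\<close>.\<close>
    show "?G i (?w j) = (if j = i then 1 else 0)" if j: "j \<in> ?J" for j
    proof -
      have "?G i (?w j) = (\<Sum>x\<in>{b1}. ?p i x (?w j x))"
        using b1 p0 by (intro sum.mono_neutral_right finite_sk) (auto simp: single_at_def)
      also have "\<dots> = r i b1 (if j = i then \<tau> j b1 else 0)"
        using \<pi>_id[OF _ ik b1F \<tau>_in[OF j b1F]] j by (simp add: single_at_def)
      also have "\<dots> = (if j = i then 1 else 0)"
        using r\<tau>[OF i b1F] p0[OF b1] \<pi>_id[OF ik ik b1F subspace_0[OF U(2)[OF ik b1F]]] by simp
      finally show ?thesis .
    qed
  qed (use H in auto)
  ultimately show ?thesis by simp
qed

end

section \<open>Ranks of block rows and of matrices with an empty block\<close>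

lemma matrix_rank_columns:
  assumes "finite C" "finite D"
  shows "matrix_rank s R (C <+> D) (case_sum V W) (\<lambda>r. case_sum (A r) (B r)) =
    vector_space.dim (pointwise_scale s)
      {matrix_map R C A v + matrix_map R D B w |v w. v \<in> family_sum C V \<and> w \<in> family_sum D W}"
proof -
  have "matrix_map R C A v + matrix_map R D B w =
      matrix_map R (C <+> D) (\<lambda>r. case_sum (A r) (B r)) (case_sum v w)" for v w
    by (simp add: matrix_map_def fun_eq_iff sum.Plus[OF assms])
  then have "matrix_map R (C <+> D) (\<lambda>r. case_sum (A r) (B r)) ` family_sum (C <+> D) (case_sum V W) =
      {matrix_map R C A v + matrix_map R D B w |v w. v \<in> family_sum C V \<and> w \<in> family_sum D W}"
    unfolding family_sum_Plus by simp blast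
  then show ?thesis
    by (simp add: matrix_rank_def lin_rank_def)
qed

lemma matrix_rank_no_columns:
  assumes "vector_space s"
  shows "matrix_rank s R {} V A = 0"
proof -
  interpret p: vector_space "pointwise_scale s"
    by (rule vector_space_pointwise_scale[OF assms])
  have "matrix_map R {} A ` family_sum {} V = {0}"
    by (simp add: family_sum_empty matrix_map_def fun_eq_iff)
  then show ?thesis
    using p.dim_le_card[of "{0}" "{}"] by (simp add: matrix_rank_def lin_rank_def)
qed

lemma matrix_rank_no_rows:
  assumes "vector_space s" "\<And>c. c \<in> C \<Longrightarrow> module.subspace s (V c)"
  shows "matrix_rank s {} C V A = 0"
proof -
  interpret p: vector_space "pointwise_scale s"
    by (rule vector_space_pointwise_scale[OF assms(1)])
  have "matrix_map {} C A ` family_sum C V \<subseteq> {0}"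
    by (auto simp: matrix_map_def fun_eq_iff)
  then show ?thesis
    using p.dim_le_card[of _ "{}"] by (simp add: matrix_rank_def lin_rank_def)
qed

lemma matrix_rank_no_right_columns:
  assumes "finite C"
  shows "matrix_rank s R (C <+> {}) (case_sum V W) A = matrix_rank s R C V (\<lambda>r c. A r (Inl c))"
proof -
  have "matrix_map R (C <+> {}) A (case_sum v 0) = matrix_map R C (\<lambda>r c. A r (Inl c)) v" for v
    by (simp add: matrix_map_def fun_eq_iff sum.Plus[OF assms finite.emptyI])
  then have "matrix_map R (C <+> {}) A ` family_sum (C <+> {}) (case_sum V W) =
      matrix_map R C (\<lambda>r c. A r (Inl c)) ` family_sum C V"
    unfolding family_sum_Plus family_sum_empty by (simp add: image_Collect[symmetric] image_image)
  then show ?thesis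
    by (simp add: matrix_rank_def lin_rank_def)
qed

section \<open>The block matrix of a representation\<close>

context incidence_rep
begin

lemma linear_M_corner:
  assumes "(a1, b1) \<in> q" "y \<in> Field q"
  shows "linear_between s (obj N x) s (obj N y) (M_corner (\<lambda>x. x) b1 a1 N y x)"
  unfolding M_corner_def
  by (cases "y = b1"; cases "x = a1")
    (use linear_smap[OF assms(1)] linear_between_zero_map[OF assms(2)] in simp_all)

lemma matrix_map_corner:
  assumes "a1 \<in> sc q" "b1 \<in> sk q"
  shows "matrix_map (sk q) (sc q) (M_corner (\<lambda>x. x) b1 a1 N) v = single_at b1 (smap N b1 a1 (v a1))"
proof
  fix y
  have "(\<Sum>x\<in>sc q. M_corner (\<lambda>x. x) b1 a1 N y x (v x)) = (\<Sum>x\<in>{a1}. M_corner (\<lambda>x. x) b1 a1 N y x (v x))"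
    using assms(1) by (intro sum.mono_neutral_right finite_sc) (auto simp: M_corner_def)
  then show "matrix_map (sk q) (sc q) (M_corner (\<lambda>x. x) b1 a1 N) v y = single_at b1 (smap N b1 a1 (v a1)) y"
    using assms(2) by (cases "y = b1") (simp_all add: matrix_map_def M_corner_def single_at_def)
qed

text \<open>Kernel vectors of \<open>M_tilde\<close> are restrictions of sections, and transport
  from \<open>a1\<close> to \<open>b1\<close> turns the value of a section at \<open>a1\<close> into
  its value at \<open>b1\<close>.\<close>

lemma canonical_map_image:
  assumes a: "bij_betw a {1..n} (sc q)" and a1: "a1 \<in> sc q" and b1: "b1 \<in> sk q" and le: "(a1, b1) \<in> q"
  shows "{matrix_map (sk q) (sc q) (M_corner (\<lambda>x. x) b1 a1 N) v +
      matrix_map (sk q) (sk1 q) (M_hat (\<lambda>x. x) b m N) w |v w.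
      v \<in> family_sum (sc q) (obj N) \<and>
      matrix_map (sc1 q) (sc q) (M_tilde (\<lambda>x. x) a n N) v = 0 \<and>
      w \<in> family_sum (sk1 q) (\<lambda>c. obj N (snd c))} =
    {single_at b1 (\<sigma> b1) + h |\<sigma> h. \<sigma> \<in> sections (obj N) \<and> h \<in> hat_image b m}" (is "?L = ?R")
proof
  have \<sigma>_smap: "smap N b1 a1 (\<sigma> a1) = \<sigma> b1" if "\<sigma> \<in> sections (obj N)" for \<sigma>
    using that le by (simp add: sections_def)
  show "?L \<subseteq> ?R"
  proof
    fix z assume "z \<in> ?L"
    then obtain v w where v: "v \<in> family_sum (sc q) (obj N)"
      "matrix_map (sc1 q) (sc q) (M_tilde (\<lambda>x. x) a n N) v = 0"
      and w: "w \<in> family_sum (sk1 q) (\<lambda>c. obj N (snd c))"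
      and z: "z = single_at b1 (smap N b1 a1 (v a1)) + matrix_map (sk q) (sk1 q) (M_hat (\<lambda>x. x) b m N) w"
      unfolding matrix_map_corner[OF a1 b1] by blast
    obtain \<sigma> where \<sigma>: "\<sigma> \<in> sections (obj N)" "\<forall>x\<in>sc q. v x = \<sigma> x"
      using M_tilde_kernel_iff[OF a v(1)] v(2) by blast
    have "z = single_at b1 (\<sigma> b1) + matrix_map (sk q) (sk1 q) (M_hat (\<lambda>x. x) b m N) w"
      unfolding z using \<sigma>_smap[OF \<sigma>(1)] \<sigma>(2) a1 by simp
    then show "z \<in> ?R"
      using \<sigma>(1) w by blast
  qed
  show "?R \<subseteq> ?L"
  proof
    fix z assume "z \<in> ?R"
    then obtain \<sigma> w where \<sigma>: "\<sigma> \<in> sections (obj N)"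
      and w: "w \<in> family_sum (sk1 q) (\<lambda>c. obj N (snd c))"
      and z: "z = single_at b1 (\<sigma> b1) + matrix_map (sk q) (sk1 q) (M_hat (\<lambda>x. x) b m N) w"
      by blast
    \<comment> \<open>The section cut off outside the minimal elements, because members of
      \<open>family_sum\<close> vanish off their index set.\<close>
    let ?v = "\<lambda>x. if x \<in> sc q then \<sigma> x else 0"
    have v: "?v \<in> family_sum (sc q) (obj N)"
      using \<sigma> sc_subset by (auto simp: family_sum_def sections_def)
    have "matrix_map (sc1 q) (sc q) (M_tilde (\<lambda>x. x) a n N) ?v = 0"
      unfolding M_tilde_kernel_iff[OF a v] using \<sigma> by (intro bexI[of _ \<sigma>]) simp_all
    moreover have "single_at b1 (\<sigma> b1) = matrix_map (sk q) (sc q) (M_corner (\<lambda>x. x) b1 a1 N) ?v"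
      unfolding matrix_map_corner[OF a1 b1] using \<sigma>_smap[OF \<sigma>] a1 by simp
    ultimately show "z \<in> ?L"
      unfolding z using v w by (intro CollectI exI[of _ ?v] exI[of _ w]) simp
  qed
qed

text \<open>The common source of the general formula and of the degenerate cases: those differ only
  in how the remaining dimension is evaluated.\<close>

lemma matrix_rank_M_block_eq_dim:
  assumes a: "bij_betw a {1..n} (sc q)" and b: "bij_betw b {1..m} (sk q)" and le: "(a 1, b 1) \<in> q"
  shows "matrix_rank s (sc1 q <+> sk q) (sc q <+> sk1 q) (case_sum (obj N) (\<lambda>c. obj N (snd c)))
      (M_block (\<lambda>x. x) a n b m N) =
    matrix_rank s (sc1 q) (sc q) (obj N) (M_tilde (\<lambda>x. x) a n N) +
    vector_space.dim (pointwise_scale s)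
      {matrix_map (sk q) (sc q) (M_corner (\<lambda>x. x) (b 1) (a 1) N) v +
        matrix_map (sk q) (sk1 q) (M_hat (\<lambda>x. x) b m N) w |v w.
        v \<in> family_sum (sc q) (obj N) \<and>
        matrix_map (sc1 q) (sc q) (M_tilde (\<lambda>x. x) a n N) v = 0 \<and>
        w \<in> family_sum (sk1 q) (\<lambda>c. obj N (snd c))}"
  unfolding M_block_def
proof (rule matrix_rank_block[where W = "\<lambda>c. obj N (snd c)" and W' = "obj N"])
  show "linear_between s (obj N c) s (obj N (snd r)) (M_tilde (\<lambda>x. x) a n N r c)"
    if "r \<in> sc1 q" "c \<in> sc q" for r c
    using linear_M_tilde[OF a that] .
  show "linear_between s (obj N c) s (obj N r) (M_corner (\<lambda>x. x) (b 1) (a 1) N r c)"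
    if "r \<in> sk q" "c \<in> sc q" for r c
    using linear_M_corner[OF le] that sk_subset by blast
  show "linear_between s (obj N (snd d)) s (obj N r) (M_hat (\<lambda>x. x) b m N r d)"
    if "r \<in> sk q" "d \<in> sk1 q" for r d
    using linear_M_hat[OF b that(2,1)] .
  show "fin_dim s (obj N (snd r))" if "r \<in> sc1 q" for r
    using fin_dim_obj[OF sc1D(3)] that by (metis prod.collapse)
  show "fin_dim s (obj N (snd r))" if "r \<in> sk1 q" for r
    using fin_dim_obj[OF sk1D(3)] that by (metis prod.collapse)
  show "fin_dim s (obj N r)" if "r \<in> sc q" for r
    using fin_dim_obj sc_subset that by blast
  show "fin_dim s (obj N r)" if "r \<in> sk q" for r
    using fin_dim_obj sk_subset that by blast
qed (rule vector_space_axioms finite_sc finite_sk finite_sc1 finite_sk1)+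

text \<open>Phrased additively, so that it is an equation of natural numbers without truncated
  subtraction.\<close>

theorem matrix_rank_M_block:
  assumes conn: "poset_connected q (Field q)" and X: "constant_module q X"
    and a: "bij_betw a {1..n} (sc q)" and b: "bij_betw b {1..m} (sk q)"
    and a1: "a 1 \<in> sc q" and b1: "b 1 \<in> sk q" and le: "(a 1, b 1) \<in> q"
  shows "matrix_rank s (sc1 q <+> sk q) (sc q <+> sk1 q) (case_sum (obj N) (\<lambda>c. obj N (snd c)))
      (M_block (\<lambda>x. x) a n b m N) =
    matrix_rank s (sc1 q) (sc q) (obj N) (M_tilde (\<lambda>x. x) a n N) +
    matrix_rank s (sk q) (sk1 q) (\<lambda>c. obj N (snd c)) (M_hat (\<lambda>x. x) b m N) + mult_in q (*) X s N"
proof -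
  let ?mult = "\<lambda>k U. card {i. i < k \<and> inc_iso q s (N\<lparr>obj := U i\<rparr>) (*) X}"
  let ?D = "{single_at (b 1) (\<sigma> (b 1)) + h |\<sigma> h. \<sigma> \<in> sections (obj N) \<and> h \<in> hat_image b m}"
  let ?dim = "vector_space.dim (pointwise_scale s :: 'k \<Rightarrow> ('x \<Rightarrow> 'v) \<Rightarrow> 'x \<Rightarrow> 'v)"
  have dim: "?dim ?D = ?dim (hat_image b m) + ?mult k U" if "indec_decomp q s N k U" for k U
    using dim_canonical_map_image[OF conn X b b1 that] .
  obtain k U where kU: "indec_decomp q s N k U"
    using indec_decomp_exists[OF incidence_rep_axioms] by blast
  have "mult_in q (*) X s N = ?mult k U"
    unfolding mult_in_def
  \<comment> \<open>A second decomposition satisfies the same dimension identity; cancelling the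
    dimension of \<open>hat_image b m\<close> gives the same count.\<close>
  proof (rule the_equality)
    fix \<mu> assume "\<exists>k U. indec_decomp q s N k U \<and> \<mu> = ?mult k U"
    then obtain k' U' where "indec_decomp q s N k' U'" "\<mu> = ?mult k' U'" by blast
    then show "\<mu> = ?mult k U"
      using dim[of k' U'] dim[OF kU] by linarith
  qed (use kU in blast)
  then have "?dim ?D = ?dim (hat_image b m) + mult_in q (*) X s N"
    using dim[OF kU] by simp
  then show ?thesis
    unfolding matrix_rank_M_block_eq_dim[OF a b le] canonical_map_image[OF a a1 b1 le]
    by (simp add: matrix_rank_def lin_rank_def)
qed

lemma matrix_map_M_tilde_no_rows: "sc1 q = {} \<Longrightarrow> matrix_map (sc1 q) C A v = 0"
  by (simp add: matrix_map_def fun_eq_iff)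

text \<open>Without rows in \<open>M_tilde\<close> the kernel condition is vacuous, and what remains
  is the column space of \<open>M_hat\<close> next to the corner block.\<close>

lemma matrix_rank_M_block_one_source:
  assumes a: "bij_betw a {1..n} (sc q)" and b: "bij_betw b {1..m} (sk q)" and le: "(a 1, b 1) \<in> q"
    and sc1: "sc1 q = {}"
  shows "matrix_rank s (sc1 q <+> sk q) (sc q <+> sk1 q) (case_sum (obj N) (\<lambda>c. obj N (snd c)))
      (M_block (\<lambda>x. x) a n b m N) =
    matrix_rank s (sc1 q) (sc q) (obj N) (M_tilde (\<lambda>x. x) a n N) +
    matrix_rank s (sk q) (sk1 q <+> sc q) (case_sum (\<lambda>c. obj N (snd c)) (obj N))
      (\<lambda>y. case_sum (M_hat (\<lambda>x. x) b m N y) (M_corner (\<lambda>x. x) (b 1) (a 1) N y))"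
  unfolding matrix_rank_M_block_eq_dim[OF a b le] matrix_rank_columns[OF finite_sk1 finite_sc]
  by (intro arg_cong2[where f = "(+)"] arg_cong[where f = "vector_space.dim (pointwise_scale s)"] refl)
    (auto simp: matrix_map_M_tilde_no_rows[OF sc1] add.commute)

text \<open>Without relations only the corner is left, and the inclusion of the summand at
  \<open>b 1\<close> preserves the dimension of the image of its entry.\<close>

lemma matrix_rank_M_block_one_source_sink:
  assumes a: "bij_betw a {1..n} (sc q)" and b: "bij_betw b {1..m} (sk q)" and le: "(a 1, b 1) \<in> q"
    and sc: "sc q = {a 1}" and sk: "b 1 \<in> sk q" and sc1: "sc1 q = {}" and sk1: "sk1 q = {}"
  shows "matrix_rank s (sc1 q <+> sk q) (sc q <+> sk1 q) (case_sum (obj N) (\<lambda>c. obj N (snd c)))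
      (M_block (\<lambda>x. x) a n b m N) =
    matrix_rank s (sc1 q) (sc q) (obj N) (M_tilde (\<lambda>x. x) a n N) +
    lin_rank s (obj N (a 1)) (smap N (b 1) (a 1))" (is "?l = _")
proof -
  interpret p: vector_space "pointwise_scale s :: 'k \<Rightarrow> ('x \<Rightarrow> 'v) \<Rightarrow> 'x \<Rightarrow> 'v"
    by (rule vector_space_pointwise_scale[OF vector_space_axioms])
  interpret vector_space_pair s "pointwise_scale s :: 'k \<Rightarrow> ('x \<Rightarrow> 'v) \<Rightarrow> 'x \<Rightarrow> 'v" ..
  have a1: "a 1 \<in> Field q" and b1: "b 1 \<in> Field q"
    using le FieldD by blast+
  have zero: "matrix_map (sk q) {} (M_hat (\<lambda>x. x) b m N) 0 = 0"
    by (simp add: matrix_map_def fun_eq_iff)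
  let ?W = "smap N (b 1) (a 1) ` obj N (a 1)"
  have "{matrix_map (sk q) (sc q) (M_corner (\<lambda>x. x) (b 1) (a 1) N) v +
        matrix_map (sk q) (sk1 q) (M_hat (\<lambda>x. x) b m N) w |v w.
        v \<in> family_sum (sc q) (obj N) \<and>
        matrix_map (sc1 q) (sc q) (M_tilde (\<lambda>x. x) a n N) v = 0 \<and>
        w \<in> family_sum (sk1 q) (\<lambda>c. obj N (snd c))} =
      {single_at (b 1) (smap N (b 1) (a 1) (v (a 1))) |v. v \<in> family_sum (sc q) (obj N)}"
    using matrix_map_corner[of "a 1" "b 1"] sc sk zero
    by (simp add: matrix_map_M_tilde_no_rows[OF sc1] sk1 family_sum_empty)
  also have "\<dots> = single_at (b 1) ` ?W"
  proof -
    have "(\<lambda>v. v (a 1)) ` family_sum (sc q) (obj N) = obj N (a 1)"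
    proof
      show "obj N (a 1) \<subseteq> (\<lambda>v. v (a 1)) ` family_sum (sc q) (obj N)"
      proof
        fix v assume "v \<in> obj N (a 1)"
        then have "single_at (a 1) v \<in> family_sum (sc q) (obj N)"
          using sc by (simp add: family_sum_def single_at_def)
        then show "v \<in> (\<lambda>v. v (a 1)) ` family_sum (sc q) (obj N)"
          by (rule image_eqI[rotated]) (simp add: single_at_def)
      qed
    qed (auto simp: family_sum_def sc)
    from this[symmetric] show ?thesis
      by (simp add: image_image Setcompr_eq_image)
  qed
  finally have "?l = matrix_rank s (sc1 q) (sc q) (obj N) (M_tilde (\<lambda>x. x) a n N) + p.dim (single_at (b 1) ` ?W)"
    unfolding matrix_rank_M_block_eq_dim[OF a b le] by simp
  moreover have "p.dim (single_at (b 1) ` ?W) = dim ?W"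
  proof -
    obtain B where B: "finite B" "obj N (b 1) \<subseteq> span B"
      using obtain_spanning_set[OF b1] .
    show ?thesis
    proof (rule dim_inj_image[OF linear_single_at[OF vector_space_axioms] _ B(1)])
      show "inj_on (single_at (b 1)) ?W"
        by (rule inj_onI) (metis single_at_def)
      show "?W \<subseteq> span B"
        using B(2) smap_in[OF le] by blast
      show "subspace ?W"
        using linear_between_image_subspace[OF vector_space_axioms vector_space_axioms subspace_obj[OF a1] linear_smap[OF le]] .
    qed
  qed
  ultimately show ?thesis
    by (simp add: lin_rank_def)
qed

end

section \<open>Transfer along the compression map\<close>

lemma inc_module_pullback:
  fixes M :: "('p, 'k::field, 'v::ab_group_add) inc_functor"
  assumes M: "inc_module r s M" and f: "order_preserving q r f"
  shows "inc_module q s (pullback f M)"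
proof -
  have fF: "f x \<in> Field r" if "x \<in> Field q" for x
    using that f unfolding order_preserving_def Field_def by blast
  have hom: "c \<in> inc_hom r (f x) (f y)" if "c \<in> inc_hom q x y" for c :: 'k and x y
    using that f by (auto simp: inc_hom_def order_preserving_def split: if_splits)
  show ?thesis
    using M fF hom by (simp add: inc_module_def pullback_def)
qed

text \<open>Because the image lies in \<open>I\<close>, every vertex sees the one-dimensional value;
  for pairs that are not comparable the only scalar is \<open>0\<close>, and both sides are
  zero.\<close>

lemma constant_module_pullback_interval_module:
  assumes "order_preserving q r f" "f ` Field q \<subseteq> I"
  shows "constant_module q (pullback f (interval_module r I))"
  using assms
  by (auto simp: constant_module_def pullback_def interval_module_def inc_hom_def order_preserving_def
      image_subset_iff split: if_splits)

lemma smap_pullback: "smap (pullback f M) y x = smap M (f y) (f x)"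
  by (simp add: smap_def pullback_def)

text \<open>Explains the identity map used as first argument so far: over the compressed poset the
  matrices belong to the pulled-back module, and the compression map reappears here.\<close>

lemma M_tilde_pullback: "M_tilde (\<lambda>x. x) a n (pullback f M) = M_tilde f a n M"
  and M_hat_pullback: "M_hat (\<lambda>x. x) b m (pullback f M) = M_hat f b m M"
  and M_corner_pullback: "M_corner (\<lambda>x. x) b1 a1 (pullback f M) = M_corner f b1 a1 M"
  unfolding M_tilde_def M_hat_def M_corner_def smap_pullback by (rule refl)+

lemma M_block_pullback: "M_block (\<lambda>x. x) a n b m (pullback f M) = M_block f a n b m M"
  unfolding M_block_def M_tilde_pullback M_hat_pullback M_corner_pullback ..

theorem mainTheorem2:
  fixes P :: "'p rel" and Q :: "'p set \<Rightarrow> 'i rel" and \<xi> :: "'p set \<Rightarrow> 'i \<Rightarrow> 'p"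
    and s :: "'k::field \<Rightarrow> 'v::ab_group_add \<Rightarrow> 'v" and M :: "('p, 'k, 'v) inc_functor"
    and I :: "'p set" and a b :: "nat \<Rightarrow> 'i" and n m :: nat
  defines "VA \<equiv> (\<lambda>x. obj M (\<xi> I x))"
    and "VD \<equiv> (\<lambda>bd :: 'i set \<times> 'i. obj M (\<xi> I (snd bd)))"
    and "Mt \<equiv> M_tilde (\<xi> I) a n M"
    and "Mh \<equiv> M_hat (\<xi> I) b m M"
    and "Mc \<equiv> M_corner (\<xi> I) (b 1) (a 1) M"
  assumes "Partial_order P" and "finite (Field P)"
    and "compression_system P Q \<xi>"
    and "inc_module P s M"
    and "poset_interval P I"
    and "n \<ge> 1" and "bij_betw a {1..n} (sc (Q I))"
    and "m \<ge> 1" and "bij_betw b {1..m} (sk (Q I))"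
    and "(a 1, b 1) \<in> Q I"
  shows
    "int (compression_mult P Q \<xi> s I M) =
       int (matrix_rank s (sc1 (Q I) <+> sk (Q I)) (sc (Q I) <+> sk1 (Q I)) (case_sum VA VD)
              (M_block (\<xi> I) a n b m M))
       - int (matrix_rank s (sc1 (Q I)) (sc (Q I)) VA Mt)
       - int (matrix_rank s (sk (Q I)) (sk1 (Q I)) VD Mh)
     \<and> (m = 1 \<longrightarrow> sk1 (Q I) = {})
     \<and> (n = 1 \<longrightarrow> sc1 (Q I) = {})
     \<and> (n = 1 \<and> m = 1 \<longrightarrow>
         compression_mult P Q \<xi> s I M =
           lin_rank s (obj M (\<xi> I (a 1))) (smap M (\<xi> I (b 1)) (\<xi> I (a 1))))
     \<and> (n \<ge> 2 \<and> m = 1 \<longrightarrow>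
         int (compression_mult P Q \<xi> s I M) =
           int (matrix_rank s (sc1 (Q I) <+> {b 1}) (sc (Q I)) VA (case_sum Mt Mc))
           - int (matrix_rank s (sc1 (Q I)) (sc (Q I)) VA Mt))
     \<and> (n = 1 \<and> m \<ge> 2 \<longrightarrow>
         int (compression_mult P Q \<xi> s I M) =
           int (matrix_rank s (sk (Q I)) (sk1 (Q I) <+> {a 1}) (case_sum VD VA)
                  (\<lambda>y. case_sum (Mh y) (Mc y)))
           - int (matrix_rank s (sk (Q I)) (sk1 (Q I)) VD Mh))"
proof -
  let ?N = "pullback (\<xi> I) M" and ?X = "pullback (\<xi> I) (interval_module P I) :: ('i, 'k, 'k) inc_functor"
  have Q: "Partial_order (Q I)" "finite (Field (Q I))" "poset_connected (Q I) (Field (Q I))"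
    "order_preserving (Q I) P (\<xi> I)" "\<xi> I ` Field (Q I) \<subseteq> I"
    using assms(8,10) unfolding compression_system_def by blast+
  interpret incidence_rep "Q I" s ?N
    using Q(1,2) inc_module_pullback[OF assms(9) Q(4)] by unfold_locales
  note a = assms(12) and b = assms(14) and le = assms(15)
  have sc: "sc (Q I) = a ` {1..n}" and sk: "sk (Q I) = b ` {1..m}"
    using a b by (simp_all add: bij_betw_def)
  have a1: "a 1 \<in> sc (Q I)" and b1: "b 1 \<in> sk (Q I)"
    using sc sk assms(11,13) by auto
  have VA: "VA = obj ?N" and VD: "VD = (\<lambda>c. obj ?N (snd c))"
    by (simp_all add: VA_def VD_def pullback_def)
  have M: "Mt = M_tilde (\<lambda>x. x) a n ?N" "Mh = M_hat (\<lambda>x. x) b m ?N"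
    "Mc = M_corner (\<lambda>x. x) (b 1) (a 1) ?N" "M_block (\<xi> I) a n b m M = M_block (\<lambda>x. x) a n b m ?N"
    unfolding Mt_def Mh_def Mc_def
    by (simp_all only: M_tilde_pullback M_hat_pullback M_corner_pullback M_block_pullback)
  let ?block = "matrix_rank s (sc1 (Q I) <+> sk (Q I)) (sc (Q I) <+> sk1 (Q I)) (case_sum VA VD)
    (M_block (\<xi> I) a n b m M)"
  \<comment> \<open>All rank formulas are read off from this identity of natural numbers.\<close>
  have main: "?block = matrix_rank s (sc1 (Q I)) (sc (Q I)) VA Mt
      + matrix_rank s (sk (Q I)) (sk1 (Q I)) VD Mh + compression_mult P Q \<xi> s I M"
    unfolding VA VD M compression_mult_def
    using matrix_rank_M_block[OF Q(3) constant_module_pullback_interval_module[OF Q(4,5)] a b a1 b1 le] .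
  have sk1: "sk1 (Q I) = {}" if "m = 1"
    using that sk by (auto simp: sk1_def subset_singleton_iff)
  have sc1: "sc1 (Q I) = {}" if "n = 1"
    using that sc by (auto simp: sc1_def subset_singleton_iff)
  have no_rows: "matrix_rank s (sc1 (Q I)) (sc (Q I)) VA Mt = 0" if "n = 1"
    unfolding sc1[OF that] VA using subspace_obj sc_subset
    by (intro matrix_rank_no_rows vector_space_axioms) blast
  have no_columns: "matrix_rank s (sk (Q I)) (sk1 (Q I)) VD Mh = 0" if "m = 1"
    unfolding sk1[OF that] by (rule matrix_rank_no_columns[OF vector_space_axioms])
  have "compression_mult P Q \<xi> s I M = lin_rank s (obj M (\<xi> I (a 1))) (smap M (\<xi> I (b 1)) (\<xi> I (a 1)))"
    if nm: "n = 1" "m = 1"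
  proof -
    have "?block = matrix_rank s (sc1 (Q I)) (sc (Q I)) VA Mt + lin_rank s (obj ?N (a 1)) (smap ?N (b 1) (a 1))"
      unfolding VA VD M
      using sc nm by (intro matrix_rank_M_block_one_source_sink a b le b1 sc1 sk1) simp_all
    then show ?thesis
      using main no_columns[OF nm(2)] by (simp add: pullback_def smap_def)
  qed
  \<comment> \<open>The accompanying inequality ensures that the subtraction of natural numbers is
    not truncated when it is carried over to integers.\<close>
  moreover have "compression_mult P Q \<xi> s I M =
      matrix_rank s (sc1 (Q I) <+> {b 1}) (sc (Q I)) VA (case_sum Mt Mc) - matrix_rank s (sc1 (Q I)) (sc (Q I)) VA Mt"
    and "matrix_rank s (sc1 (Q I)) (sc (Q I)) VA Mt \<le>
      matrix_rank s (sc1 (Q I) <+> {b 1}) (sc (Q I)) VA (case_sum Mt Mc)" if m: "m = 1"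
  proof -
    have "(\<lambda>r c. M_block (\<xi> I) a n b m M r (Inl c)) = case_sum Mt Mc"
      by (auto simp: M_block_def Mt_def Mc_def fun_eq_iff split: sum.split)
    then have "?block = matrix_rank s (sc1 (Q I) <+> {b 1}) (sc (Q I)) VA (case_sum Mt Mc)"
      unfolding sk1[OF m] matrix_rank_no_right_columns[OF finite_sc] using sk m by simp
    then show "compression_mult P Q \<xi> s I M =
        matrix_rank s (sc1 (Q I) <+> {b 1}) (sc (Q I)) VA (case_sum Mt Mc) - matrix_rank s (sc1 (Q I)) (sc (Q I)) VA Mt"
      "matrix_rank s (sc1 (Q I)) (sc (Q I)) VA Mt \<le>
        matrix_rank s (sc1 (Q I) <+> {b 1}) (sc (Q I)) VA (case_sum Mt Mc)"
      using main no_columns[OF m] by linarith+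
  qed
  \<comment> \<open>The block row has the corner on the right here, whereas the large matrix has it
    on the left; the set of sums is the same.\<close>
  moreover have "matrix_rank s (sk (Q I)) (sk1 (Q I) <+> {a 1}) (case_sum VD VA) (\<lambda>y. case_sum (Mh y) (Mc y)) =
      matrix_rank s (sk (Q I)) (sk1 (Q I)) VD Mh + compression_mult P Q \<xi> s I M" if n: "n = 1"
  proof -
    have "?block = matrix_rank s (sc1 (Q I)) (sc (Q I)) VA Mt +
        matrix_rank s (sk (Q I)) (sk1 (Q I) <+> sc (Q I)) (case_sum VD VA) (\<lambda>y. case_sum (Mh y) (Mc y))"
      unfolding VA VD M by (rule matrix_rank_M_block_one_source[OF a b le sc1[OF n]])
    moreover have "sc (Q I) = {a 1}"
      using sc n by simp
    ultimately show ?thesis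
      using main by simp
  qed
  ultimately show ?thesis
    using main sc1 sk1 by auto
qed

end
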